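(* In the setting below, the field $\mathfrak R_\theta=k(\sqrt[3]{\pi_1},\sqrt[3]{\pi_2},\sqrt[3]{\theta})$ is independent of the choice of admissible $\theta\in\mathcal O_{K_1}$: if $\theta,\theta'$ are both admissible then $\mathfrak R_\theta=\mathfrak R_{\theta'}$.
   Context: $k=\mathbb Q(\zeta_3)$, $\zeta_3=\frac{-1+\sqrt{-3}}{2}$, $\mathcal O_k=\mathbb Z[\zeta_3]$. Let $\mathfrak p_1,\mathfrak p_2$ be distinct finite primes of $k$ not above $3$ with $\mathrm N\mathfrak p_i\equiv1\bmod9$, and $\pi_i\in\mathcal O_k$ the unique generators of $\mathfrak p_i$ with $\pi_i\equiv1\bmod(3\sqrt{-3})$. Assume $\pi_1$ is a cube in $k_{\mathfrak p_2}^\times$ and $\pi_2$ is a cube in $k_{\mathfrak p_1}^\times$. Let $K_1=k(\sqrt[3]{\pi_1})$ and $\tau\in\mathrm{Gal}(K_1/k)$ with $\tau(\sqrt[3]{\pi_1})=\zeta_3\sqrt[3]{\pi_1}$. Fix a prime $\mathfrak P$ of $K_1$ over $\mathfrak p_2$. Call $\theta\in\mathcal O_{K_1}$ admissible if $\theta=\zeta_3^c\,\alpha^2\tau(\alpha)$ for some $c\in\{0,1,2\}$ and some $\alpha\in\mathcal O_{K_1}$ with $\mathrm N_{K_1/k}(\alpha)=\pi_2\beta^3$ for some $\beta\in k$ and $(\alpha)=\mathfrak P^a\mathfrak B^b$ with $3\nmid a$, $\mathfrak B$ an ideal coprime to $3$, $3\mid b$; and moreover there exists $\eta\in\mathcal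 O_{K_1}$ with $\eta^3\equiv\theta\bmod(3\sqrt{-3})\mathcal O_{K_1}$. *)

theory Defs
  imports Complex_Main "HOL-Computational_Algebra.Polynomial"
begin

definition zeta3 :: complex where
  "zeta3 = Complex (-1/2) (sqrt 3 / 2)"

definition sqrtm3 :: complex where
  "sqrtm3 = 2 * zeta3 + 1"

definition kF :: "complex set" where
  "kF = {of_rat a + of_rat b * zeta3 | a b. True}"

definition Ok :: "complex set" where
  "Ok = {of_int a + of_int b * zeta3 | a b. True}"

definition dvd_in :: "complex set \<Rightarrow> complex \<Rightarrow> complex \<Rightarrow> bool" where
  "dvd_in R a b \<longleftrightarrow> (\<exists>x\<in>R. b = a * x)"

definition cong_in :: "complex set \<Rightarrow> complex \<Rightarrow> complex \<Rightarrow> complex \<Rightarrow> bool" where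
  "cong_in R m a b \<longleftrightarrow> dvd_in R m (a - b)"

definition prime_elem_in :: "complex set \<Rightarrow> complex \<Rightarrow> bool" where
  "prime_elem_in R p \<longleftrightarrow> p \<in> R \<and> p \<noteq> 0 \<and> \<not> (\<exists>u\<in>R. p * u = 1) \<and>
     (\<forall>a\<in>R. \<forall>b\<in>R. dvd_in R p (a * b) \<longrightarrow> dvd_in R p a \<or> dvd_in R p b)"

text \<open>a (a unit at the prime (p)) is a cube in the completion of the fraction field
  of R at (p): there are approximate cube roots modulo every power of p.\<close>
definition cube_in_completion :: "complex set \<Rightarrow> complex \<Rightarrow> complex \<Rightarrow> bool" where
  "cube_in_completion R p a \<longleftrightarrow> (\<forall>n::nat. \<exists>x\<in>R. cong_in R (p ^ n) (x ^ 3) a)"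

definition alg_int :: "complex \<Rightarrow> bool" where
  "alg_int x \<longleftrightarrow> (\<exists>p :: int poly. lead_coeff p = 1 \<and> poly (map_poly of_int p) x = 0)"

text \<open>K1 = k(rho) with rho^3 = pi1, and its ring of integers.\<close>
definition K1 :: "complex \<Rightarrow> complex set" where
  "K1 \<rho> = {c0 + c1 * \<rho> + c2 * \<rho>^2 | c0 c1 c2. c0 \<in> kF \<and> c1 \<in> kF \<and> c2 \<in> kF}"

definition OK1 :: "complex \<Rightarrow> complex set" where
  "OK1 \<rho> = {x \<in> K1 \<rho>. alg_int x}"

definition ideal_in :: "complex set \<Rightarrow> complex set \<Rightarrow> bool" where
  "ideal_in R I \<longleftrightarrow> I \<subseteq> R \<and> 0 \<in> I \<and> (\<forall>x\<in>I. \<forall>y\<in>I. x + y \<in> I) \<and>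
     (\<forall>r\<in>R. \<forall>x\<in>I. r * x \<in> I)"

definition principal :: "complex set \<Rightarrow> complex \<Rightarrow> complex set" where
  "principal R a = {a * x | x. x \<in> R}"

definition ideal_mult :: "complex set \<Rightarrow> complex set \<Rightarrow> complex set \<Rightarrow> complex set" where
  "ideal_mult R I J = \<Inter> {L. ideal_in R L \<and> {a * b | a b. a \<in> I \<and> b \<in> J} \<subseteq> L}"

fun ideal_pow :: "complex set \<Rightarrow> complex set \<Rightarrow> nat \<Rightarrow> complex set" where
  "ideal_pow R I 0 = R"
| "ideal_pow R I (Suc n) = ideal_mult R I (ideal_pow R I n)"

definition prime_ideal_in :: "complex set \<Rightarrow> complex set \<Rightarrow> bool" where
  "prime_ideal_in R P \<longleftrightarrow> ideal_in R P \<and> P \<noteq> R \<and>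
     (\<forall>a\<in>R. \<forall>b\<in>R. a * b \<in> P \<longrightarrow> a \<in> P \<or> b \<in> P)"

definition coprime_ideals :: "complex set \<Rightarrow> complex set \<Rightarrow> bool" where
  "coprime_ideals I J \<longleftrightarrow> (\<exists>x\<in>I. \<exists>y\<in>J. x + y = 1)"

definition subfield_C :: "complex set \<Rightarrow> bool" where
  "subfield_C F \<longleftrightarrow> 0 \<in> F \<and> 1 \<in> F \<and> (\<forall>x\<in>F. \<forall>y\<in>F. x + y \<in> F \<and> x - y \<in> F \<and> x * y \<in> F) \<and>
     (\<forall>x\<in>F. x \<noteq> 0 \<longrightarrow> inverse x \<in> F)"

definition gen_field :: "complex set \<Rightarrow> complex set" where
  "gen_field S = \<Inter> {F. subfield_C F \<and> S \<subseteq> F}"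

text \<open>Relative norm N_{K1/k} via the generator tau of Gal(K1/k).\<close>
definition normK1 :: "(complex \<Rightarrow> complex) \<Rightarrow> complex \<Rightarrow> complex" where
  "normK1 \<tau> x = x * \<tau> x * \<tau> (\<tau> x)"

text \<open>Admissibility of theta (relative to rho, tau, pi2 and the prime P of K1 over p2).\<close>
definition admissible ::
  "complex \<Rightarrow> (complex \<Rightarrow> complex) \<Rightarrow> complex \<Rightarrow> complex set \<Rightarrow> complex \<Rightarrow> bool" where
  "admissible \<rho> \<tau> \<pi>2 P \<theta> \<longleftrightarrow> \<theta> \<in> OK1 \<rho> \<and>
     (\<exists>(c::nat) \<alpha> \<beta> (a::nat) (b::nat) B. c < 3 \<and> \<alpha> \<in> OK1 \<rho> \<and> \<beta> \<in> kF \<and>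
        normK1 \<tau> \<alpha> = \<pi>2 * \<beta> ^ 3 \<and>
        ideal_in (OK1 \<rho>) B \<and> coprime_ideals B (principal (OK1 \<rho>) 3) \<and>
        \<not> 3 dvd a \<and> 3 dvd b \<and>
        principal (OK1 \<rho>) \<alpha> = ideal_mult (OK1 \<rho>) (ideal_pow (OK1 \<rho>) P a) (ideal_pow (OK1 \<rho>) B b) \<and>
        \<theta> = zeta3 ^ c * \<alpha> ^ 2 * \<tau> \<alpha>) \<and>
     (\<exists>\<eta>\<in>OK1 \<rho>. cong_in (OK1 \<rho>) (3 * sqrtm3) (\<eta> ^ 3) \<theta>)"

end

theory Submission
  imports Defs "Jordan_Normal_Form.Char_Poly" "HOL-Library.Set_Algebras"
begin

text \<open>
  Choose \<open>s \<in> {1, 2}\<close> such that 3 divides the exponent of \<open>P\<close> in \<open>\<gamma> = \<alpha> \<alpha>'\<^sup>s\<close>; then \<open>\<gamma>\<close> generates the cube of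
  an ideal. It suffices that \<open>u = \<theta> \<theta>'\<^sup>s = \<zeta>\<^sup>c \<gamma>\<^sup>2 \<tau>(\<gamma>)\<close>, which is a cube modulo \<open>3\<surd>-3\<close>, is a cube in \<open>K\<close>.
  Morally, the cube root of \<open>u\<close> generates an unramified extension of \<open>K\<close>, and there is none because only one
  prime ramifies in \<open>K/k\<close>. Class field theory is avoided by descent along \<open>\<tau>\<close>: if \<open>\<tau> x = x y\<^sup>3\<close> with \<open>N y = 1\<close>,
  then Hilbert 90 gives \<open>x = m z\<^sup>3\<close> with \<open>m \<in> k\<close>. Modulo a prime \<open>q\<close> of \<open>k\<close> not dividing \<open>\<pi>\<^sub>1\<close> the ring of
  integers of \<open>K\<close> is reduced, so the exponent of \<open>q\<close> in \<open>m\<close> is divisible by 3 whenever \<open>x\<close> generates the cube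
  of an ideal; since \<open>\<pi>\<^sub>1\<close> is itself a cube in \<open>K\<close>, only a root of unity remains, and the congruence
  modulo \<open>3\<surd>-3\<close> removes it. The descent applies first to \<open>x = u \<tau>(u)\<^sup>2\<close> and then to \<open>x = u\<close>.
\<close>

section \<open>Algebraic integers\<close>

text \<open>Write the nonzero elements of K modulo cubes additively, as a module over F_3[\<tau>].
  There \<tau> - 1 is nilpotent: its square is the norm 1 + \<tau> + \<tau>^2 and its cube is 0. Up
  to a root of unity u is (\<tau> - 1) \<gamma>, which is why two rounds of descent are needed: the
  first element is (1 - \<tau>) u, fixed because N u is the cube of N \<gamma>; once it is a cube, u
  itself is fixed. Being fixed modulo cubes only yields N(y)^3 = 1, whereas Hilbert 90 asks for N(y)
  = 1; both times this comes from the special shape of u. The other obstacle is the prime sqrt(-3),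
  where adjoining a cube root may ramify. The congruence for \<open>\<pi>\<close> modulo 3 sqrt(-3)
  excludes this: (\<rho> - 1)/sqrt(-3) is integral and satisfies an Artin-Schreier equation modulo
  sqrt(-3). Ideals of K are never factored. Only exact powers of primes q of the Euclidean ring
  \<open>Ok\<close> are compared, and reducedness modulo q makes them compatible with
  cubing.\<close>

lemma alg_int_iff_algebraic_int: "alg_int x \<longleftrightarrow> algebraic_int x"
  unfolding alg_int_def algebraic_int_altdef_ipoly by blast

interpretation int_module: Modules.module "\<lambda>(n::int) (x::complex). of_int n * x"
  by unfold_locales (simp_all add: algebra_simps)

lemma alg_int_if_eigenvalue:
  fixes M :: "nat \<Rightarrow> nat \<Rightarrow> int" and v :: "nat \<Rightarrow> complex"
  assumes eig: "\<And>i. i < n \<Longrightarrow> x * v i = (\<Sum>j<n. of_int (M i j) * v j)"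
    and nz: "k < n" "v k \<noteq> 0"
  shows "alg_int x"
proof -
  define A where "A = mat n n (\<lambda>(i,j). M i j)"
  define A' where "A' = (map_mat of_int A :: complex mat)"
  have A: "A \<in> carrier_mat n n" and A': "A' \<in> carrier_mat n n" by (simp_all add: A_def A'_def)
  have "eigenvector A' (vec n v) x"
    unfolding eigenvector_def
  proof (intro conjI)
    show "vec n v \<in> carrier_vec (dim_row A')" using A' by simp
    show "vec n v \<noteq> 0\<^sub>v (dim_row A')"
    proof
      assume "vec n v = 0\<^sub>v (dim_row A')"
      hence "vec n v $ k = 0\<^sub>v (dim_row A') $ k" by simp
      with nz A' show False by simp
    qed
    show "A' *\<^sub>v vec n v = x \<cdot>\<^sub>v vec n v"
      by (rule eq_vecI)
        (auto simp: A'_def A_def eig scalar_prod_def lessThan_atLeast0)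
  qed
  hence "poly (char_poly A') x = 0"
    using eigenvalue_root_char_poly[OF A'] by (auto simp: eigenvalue_def)
  moreover have "char_poly A' = map_poly of_int (char_poly A)"
    unfolding A'_def by (rule of_int_hom.char_poly_hom[OF A])
  moreover have "lead_coeff (char_poly A) = 1"
    using degree_monic_char_poly[OF A] by simp
  ultimately show ?thesis unfolding alg_int_def by metis
qed

text \<open>Determinant trick: on the generators, multiplication by \<open>x\<close> is given by an
  integer matrix, and the generators themselves, listed as a vector, are an eigenvector with
  eigenvalue \<open>x\<close>.\<close>

lemma alg_int_if_stable_lattice:
  fixes B :: "complex set"
  assumes fin: "finite B" and nz: "b \<in> B" "b \<noteq> 0"
    and stable: "\<And>b. b \<in> B \<Longrightarrow> x * b \<in> int_module.span B"
  shows "alg_int x"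
proof -
  obtain g where g: "bij_betw g {..<card B} B"
    using ex_bij_betw_nat_finite[OF fin] by (auto simp: lessThan_atLeast0)
  have "\<exists>u. x * c = (\<Sum>d\<in>B. of_int (u d) * d)" if "c \<in> B" for c
    using stable[OF that] unfolding int_module.span_finite[OF fin] by auto
  then obtain u where u: "\<And>c. c \<in> B \<Longrightarrow> x * c = (\<Sum>d\<in>B. of_int (u c d) * d)" by metis
  have gB: "g i \<in> B" if "i < card B" for i using g that by (auto simp: bij_betw_def)
  obtain k where k: "k < card B" "g k = b"
    using g nz by (force simp: bij_betw_def image_iff)
  show ?thesis
  proof (rule alg_int_if_eigenvalue[where v = g and n = "card B" and M = "\<lambda>i j. u (g i) (g j)"])
    fix i assume i: "i < card B"
    have "(\<Sum>d\<in>B. complex_of_int (u (g i) d) * d) = (\<Sum>j<card B. of_int (u (g i) (g j)) * g j)"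
      using sum.reindex_bij_betw[OF g, of "\<lambda>d. complex_of_int (u (g i) d) * d"] by simp
    then show "x * g i = (\<Sum>j<card B. of_int (u (g i) (g j)) * g j)"
      using u[OF gB[OF i]] by simp
  qed (use k nz in auto)
qed

lemma alg_int_power_relation:
  assumes "alg_int x"
  obtains n c where "0 < n" "x ^ n = (\<Sum>i<n. of_int (c i) * x ^ i)"
proof -
  obtain p :: "int poly" where p: "lead_coeff p = 1" "poly (map_poly of_int p) x = 0"
    using assms unfolding alg_int_def by blast
  define n where "n = degree p"
  have "0 < n"
  proof (rule ccontr)
    assume "\<not> 0 < n"
    then obtain a where "p = [:a:]" by (metis degree_eq_zeroE n_def neq0_conv)
    with p show False by simp
  qed
  have "0 = (\<Sum>i\<le>n. of_int (coeff p i) * x ^ i)"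
    using p(2) by (simp add: poly_altdef n_def coeff_map_poly degree_map_poly)
  also have "\<dots> = (\<Sum>i<n. of_int (coeff p i) * x ^ i) + x ^ n"
    using p(1) by (simp flip: lessThan_Suc_atMost add: n_def)
  finally have "x ^ n = (\<Sum>i<n. of_int (- coeff p i) * x ^ i)"
    by (simp add: sum_negf eq_neg_iff_add_eq_0 add.commute)
  with \<open>0 < n\<close> show ?thesis using that[of n "\<lambda>i. - coeff p i"] by simp
qed

text \<open>The monomials in \<open>x\<close> and \<open>y\<close> with exponents below the degrees
  of the two monic relations span a lattice that is stable under both numbers.\<close>

lemma alg_int_add_mult:
  assumes "alg_int x" "alg_int y"
  shows "alg_int (x + y)" "alg_int (x * y)"
proof -
  obtain m c where m: "0 < m" "x ^ m = (\<Sum>i<m. of_int (c i) * x ^ i)"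
    using alg_int_power_relation[OF assms(1)] .
  obtain n d where n: "0 < n" "y ^ n = (\<Sum>i<n. of_int (d i) * y ^ i)"
    using alg_int_power_relation[OF assms(2)] .
  define B where "B = (\<lambda>(i,j). x ^ i * y ^ j) ` ({..<m} \<times> {..<n})"
  let ?L = "int_module.span B"
  have fin: "finite B" by (simp add: B_def)
  have one: "1 \<in> B" unfolding B_def by (rule image_eqI[of _ _ "(0,0)"]) (use m n in auto)
  have base: "x ^ i * y ^ j \<in> ?L" if "i < m" "j < n" for i j
    by (rule int_module.span_base) (use that in \<open>auto simp: B_def\<close>)
  have xB: "x * b \<in> ?L" if b: "b \<in> B" for b
  proof -
    obtain i j where ij: "i < m" "j < n" "b = x ^ i * y ^ j" using b by (auto simp: B_def)
    show ?thesis
    proof (cases "Suc i < m")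
      case True
      then show ?thesis using base[of "Suc i" j] ij by (simp add: mult.assoc)
    next
      case False
      hence "x * b = x ^ m * y ^ j"
        using ij by (metis Suc_lessI mult.assoc power_Suc)
      also have "\<dots> = (\<Sum>l<m. of_int (c l) * (x ^ l * y ^ j))"
        by (simp add: m sum_distrib_right mult.assoc)
      also have "\<dots> \<in> ?L"
        by (intro int_module.span_sum int_module.span_scale base) (use ij in auto)
      finally show ?thesis .
    qed
  qed
  have yB: "y * b \<in> ?L" if b: "b \<in> B" for b
  proof -
    obtain i j where ij: "i < m" "j < n" "b = x ^ i * y ^ j" using b by (auto simp: B_def)
    show ?thesis
    proof (cases "Suc j < n")
      case True
      then show ?thesis using base[of i "Suc j"] ij by (simp add: ac_simps)
    next
      case False
      hence "Suc j = n" using ij by simp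
      hence "y * b = x ^ i * y ^ n"
        using ij by (auto simp: ac_simps)
      also have "\<dots> = (\<Sum>l<n. of_int (d l) * (x ^ i * y ^ l))"
        by (simp add: n sum_distrib_left ac_simps)
      also have "\<dots> \<in> ?L"
        by (intro int_module.span_sum int_module.span_scale base) (use ij in auto)
      finally show ?thesis .
    qed
  qed
  \<comment> \<open>Stability on the whole span, not just on generators: for the product,
    \<open>x\<close> is applied after \<open>y\<close>.\<close>
  have xL: "x * l \<in> ?L" if "l \<in> ?L" for l
    using that
  proof (induction rule: int_module.span_induct_alt)
    case (step k b l)
    have "of_int k * (x * b) + x * l \<in> ?L"
      by (intro int_module.span_add int_module.span_scale xB step)
    then show ?case by (simp add: algebra_simps)
  qed (simp add: int_module.span_zero)
  show "alg_int (x + y)"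
    by (rule alg_int_if_stable_lattice[OF fin one])
      (auto simp: distrib_right intro!: int_module.span_add xB yB)
  show "alg_int (x * y)"
    by (rule alg_int_if_stable_lattice[OF fin one])
      (auto simp: mult.assoc intro!: xL yB)
qed

lemma alg_int_of_int [simp]: "alg_int (of_int n)"
  by (simp add: alg_int_iff_algebraic_int)

lemma alg_int_diff: "alg_int x \<Longrightarrow> alg_int y \<Longrightarrow> alg_int (x - y)"
  using alg_int_add_mult(1)[of x "- y"] by (simp add: alg_int_iff_algebraic_int)

lemma alg_int_cube_root: "alg_int (x ^ 3) \<Longrightarrow> alg_int x"
  unfolding alg_int_iff_algebraic_int
  by (rule algebraic_int_root[where p = "monom 1 3"])
    (auto simp: poly_monom degree_monom_eq)

lemma alg_int_cnj:
  assumes "alg_int x"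
  shows "alg_int (cnj x)"
proof -
  obtain p :: "int poly" where p: "lead_coeff p = 1" "poly (map_poly of_int p) x = 0"
    using assms unfolding alg_int_def by blast
  have "cnj (poly (map_poly of_int p) x) = poly (map_poly of_int p) (cnj x)"
    by (rule poly_cnj_real) (simp add: coeff_map_poly)
  with p show ?thesis unfolding alg_int_def by (metis complex_cnj_zero)
qed

section \<open>Divisibility and ideals in subrings of the complex numbers\<close>

locale complex_subring =
  fixes R :: "complex set"
  assumes zero_mem: "0 \<in> R" and one_mem: "1 \<in> R"
    and add_mem: "x \<in> R \<Longrightarrow> y \<in> R \<Longrightarrow> x + y \<in> R"
    and diff_mem: "x \<in> R \<Longrightarrow> y \<in> R \<Longrightarrow> x - y \<in> R"
    and mult_mem: "x \<in> R \<Longrightarrow> y \<in> R \<Longrightarrow> x * y \<in> R"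
begin

lemma minus_mem: "x \<in> R \<Longrightarrow> - x \<in> R"
  using diff_mem[OF zero_mem] by simp

lemma power_mem: "x \<in> R \<Longrightarrow> x ^ n \<in> R"
  by (induction n) (auto intro: one_mem mult_mem)

lemma of_nat_mem: "of_nat n \<in> R"
  by (induction n) (auto intro: zero_mem one_mem add_mem)

lemma of_int_mem: "of_int n \<in> R"
  by (cases n rule: int_cases2) (auto intro: of_nat_mem minus_mem)

lemma numeral_mem: "numeral n \<in> R"
  using of_nat_mem[of "numeral n"] by simp

lemmas closed = zero_mem one_mem add_mem diff_mem mult_mem minus_mem power_mem
  of_nat_mem of_int_mem numeral_mem

lemma dvd_inI: "x \<in> R \<Longrightarrow> b = a * x \<Longrightarrow> dvd_in R a b"
  by (auto simp: dvd_in_def)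

lemma dvd_in_add: "dvd_in R a x \<Longrightarrow> dvd_in R a y \<Longrightarrow> dvd_in R a (x + y)"
  unfolding dvd_in_def by (metis add_mem distrib_left)

lemma dvd_in_diff: "dvd_in R a x \<Longrightarrow> dvd_in R a y \<Longrightarrow> dvd_in R a (x - y)"
  unfolding dvd_in_def by (metis diff_mem right_diff_distrib)

lemma dvd_in_mult_left: "dvd_in R a x \<Longrightarrow> r \<in> R \<Longrightarrow> dvd_in R a (r * x)"
  unfolding dvd_in_def by (metis mult_mem mult.left_commute)

lemma dvd_in_mult_right: "dvd_in R a x \<Longrightarrow> r \<in> R \<Longrightarrow> dvd_in R a (x * r)"
  using dvd_in_mult_left[of a x r] by (simp add: mult.commute)

lemma dvd_in_self: "r \<in> R \<Longrightarrow> dvd_in R a (a * r)"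
  by (auto simp: dvd_in_def)

lemma dvd_in_refl: "dvd_in R a a"
  using dvd_in_self[OF one_mem] by simp

lemma dvd_in_0: "dvd_in R a 0"
  using dvd_in_self[OF zero_mem] by simp

lemma dvd_in_uminus: "dvd_in R a x \<Longrightarrow> dvd_in R a (- x)"
  using dvd_in_diff[OF dvd_in_0] by simp

lemma dvd_in_trans: "dvd_in R a b \<Longrightarrow> dvd_in R b c \<Longrightarrow> dvd_in R a c"
  unfolding dvd_in_def by (metis mult_mem mult.assoc)

lemma dvd_in_mult_mono: "dvd_in R a b \<Longrightarrow> dvd_in R c d \<Longrightarrow> dvd_in R (a * c) (b * d)"
  unfolding dvd_in_def by (metis mult_mem mult.assoc mult.left_commute)

lemma dvd_in_mem: "dvd_in R a b \<Longrightarrow> a \<in> R \<Longrightarrow> b \<in> R"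
  by (auto simp: dvd_in_def mult_mem)

lemma dvd_in_cancel: "c \<noteq> 0 \<Longrightarrow> dvd_in R (c * a) (c * b) \<longleftrightarrow> dvd_in R a b"
  by (auto simp: dvd_in_def mult.assoc)

lemma cong_in_trans: "cong_in R m a b \<Longrightarrow> cong_in R m b c \<Longrightarrow> cong_in R m a c"
  unfolding cong_in_def using dvd_in_add[of m "a - b" "b - c"] by simp

lemma cong_in_refl: "cong_in R m a a"
  by (simp add: cong_in_def dvd_in_0)

lemma cong_in_mult:
  assumes "cong_in R m a b" "cong_in R m c d" "b \<in> R" "c \<in> R"
  shows "cong_in R m (a * c) (b * d)"
proof -
  have "a * c - b * d = (a - b) * c + b * (c - d)" by (simp add: algebra_simps)
  then show ?thesis using assms unfolding cong_in_def
    by (metis dvd_in_add dvd_in_mult_left dvd_in_mult_right)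
qed

lemma cong_in_power:
  assumes "cong_in R m a b" "a \<in> R" "b \<in> R"
  shows "cong_in R m (a ^ n) (b ^ n)"
  by (induction n) (auto intro!: cong_in_refl cong_in_mult assms power_mem)

text \<open>Ideals are handled through generating sets with elementwise products. Sets form a
  commutative monoid under this product, so regrouping the exponents of several ideals becomes plain
  monoid algebra, and the generated ideal is taken only once.\<close>

definition gen_ideal :: "complex set \<Rightarrow> complex set" where
  "gen_ideal S = \<Inter> {L. ideal_in R L \<and> S \<subseteq> L}"

lemma ideal_in_R: "ideal_in R R"
  by (auto simp: ideal_in_def intro: closed)

lemma gen_ideal_subset: "S \<subseteq> gen_ideal S"
  by (auto simp: gen_ideal_def)

lemma gen_ideal_minimal: "ideal_in R L \<Longrightarrow> S \<subseteq> L \<Longrightarrow> gen_ideal S \<subseteq> L"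
  by (auto simp: gen_ideal_def)

lemma ideal_gen_ideal: "S \<subseteq> R \<Longrightarrow> ideal_in R (gen_ideal S)"
  using gen_ideal_minimal[OF ideal_in_R] unfolding ideal_in_def
  by (auto simp: gen_ideal_def ideal_in_def)

lemma gen_ideal_of_ideal: "ideal_in R I \<Longrightarrow> gen_ideal I = I"
  using gen_ideal_minimal gen_ideal_subset by blast

lemma ideal_mult_eq: "ideal_mult R I J = gen_ideal (I * J)"
proof -
  have "{a * b | a b. a \<in> I \<and> b \<in> J} = I * J" by (auto simp: set_times_def)
  then show ?thesis by (simp add: ideal_mult_def gen_ideal_def)
qed

lemma set_times_subset: "S \<subseteq> R \<Longrightarrow> T \<subseteq> R \<Longrightarrow> S * T \<subseteq> R"
  by (auto simp: set_times_def intro: mult_mem)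

lemma set_power_subset: "S \<subseteq> R \<Longrightarrow> S ^ n \<subseteq> R"
  by (induction n) (simp_all add: one_mem set_times_subset)

text \<open>For a fixed \<open>w\<close>, the elements that multiply \<open>w\<close> into a given
  ideal form an ideal. Hence membership passes from generators to generated ideals, one factor at a
  time.\<close>

lemma gen_ideal_mult:
  assumes S: "S \<subseteq> R" and T: "T \<subseteq> R"
  shows "gen_ideal (gen_ideal S * gen_ideal T) = gen_ideal (S * T)"
proof
  let ?L = "gen_ideal (S * T)"
  have L: "ideal_in R ?L" by (intro ideal_gen_ideal set_times_subset S T)
  have absorb: "gen_ideal V \<subseteq> {r \<in> R. r * w \<in> ?L}" if "V \<subseteq> {r \<in> R. r * w \<in> ?L}" for V w
    using that L
    by (intro gen_ideal_minimal) (auto simp: ideal_in_def distrib_right mult.assoc intro: closed)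
  have "gen_ideal S \<subseteq> {r \<in> R. r * t \<in> ?L}" if "t \<in> T" for t
    using S that by (intro absorb) (auto intro!: subsetD[OF gen_ideal_subset])
  hence "gen_ideal T \<subseteq> {r \<in> R. r * s \<in> ?L}" if "s \<in> gen_ideal S" for s
    using T that by (intro absorb) (auto simp: mult.commute)
  hence "gen_ideal S * gen_ideal T \<subseteq> ?L" by (force simp: set_times_def mult.commute)
  then show "gen_ideal (gen_ideal S * gen_ideal T) \<subseteq> ?L"
    by (rule gen_ideal_minimal[OF L])
  have "ideal_in R (gen_ideal (gen_ideal S * gen_ideal T))"
    using gen_ideal_minimal[OF ideal_in_R] S T
    by (intro ideal_gen_ideal set_times_subset) auto
  then show "?L \<subseteq> gen_ideal (gen_ideal S * gen_ideal T)"
    by (rule gen_ideal_minimal)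
      (meson gen_ideal_subset order_trans set_times_mono2)
qed

lemma principal_eq: "principal R a = {x. dvd_in R a x}"
  by (auto simp: principal_def dvd_in_def)

lemma ideal_principal: "a \<in> R \<Longrightarrow> ideal_in R {x. dvd_in R a x}"
  unfolding ideal_in_def by (auto intro: dvd_in_mem dvd_in_0 dvd_in_add dvd_in_mult_left)

lemma principal_mult:
  assumes "a \<in> R" "b \<in> R"
  shows "gen_ideal (principal R a * principal R b) = principal R (a * b)"
proof
  show "gen_ideal (principal R a * principal R b) \<subseteq> principal R (a * b)"
    unfolding principal_eq using assms
    by (intro gen_ideal_minimal ideal_principal)
      (auto simp: set_times_def intro: mult_mem dvd_in_mult_mono)
  have "principal R a * principal R b \<subseteq> R"
    unfolding principal_eq using assms by (intro set_times_subset) (auto intro: dvd_in_mem)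
  hence L: "ideal_in R (gen_ideal (principal R a * principal R b))" by (rule ideal_gen_ideal)
  have "a * b \<in> principal R a * principal R b"
    unfolding principal_eq by (auto intro!: set_times_intro dvd_in_refl)
  hence "a * b \<in> gen_ideal (principal R a * principal R b)"
    using gen_ideal_subset by blast
  then show "principal R (a * b) \<subseteq> gen_ideal (principal R a * principal R b)"
    using L unfolding principal_def ideal_in_def by (auto simp: mult.commute)
qed

lemma gen_ideal_mult_principal:
  assumes "a \<in> R" "b \<in> R" "S \<subseteq> R" "T \<subseteq> R"
    and "gen_ideal S = principal R a" "gen_ideal T = principal R b"
  shows "gen_ideal (S * T) = principal R (a * b)"
  using gen_ideal_mult[OF assms(3,4)] principal_mult[OF assms(1,2)] assms(5,6) by simp

lemma ideal_pow_eq: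
  assumes "ideal_in R I"
  shows "ideal_pow R I n = gen_ideal (I ^ n)"
proof (induction n)
  case 0
  \<comment> \<open>The zeroth power of a set is the singleton of 1, which generates all of
    \<open>R\<close>; this matches the base case of \<open>ideal_pow\<close>.\<close>
  have "r \<in> L" if "ideal_in R L" "1 \<in> L" "r \<in> R" for L r
    using that unfolding ideal_in_def by (metis mult.right_neutral)
  then show ?case
    using gen_ideal_minimal[OF ideal_in_R, of 1] one_mem
    by (auto simp: gen_ideal_def)
next
  case (Suc n)
  have I: "I \<subseteq> R" using assms by (simp add: ideal_in_def)
  have "ideal_pow R I (Suc n) = gen_ideal (gen_ideal I * gen_ideal (I ^ n))"
    using Suc assms by (simp add: ideal_mult_eq gen_ideal_of_ideal)
  also have "\<dots> = gen_ideal (I ^ Suc n)"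
    using gen_ideal_mult[OF I set_power_subset[OF I]] by simp
  finally show ?case .
qed

lemma principal_one_unit:
  assumes "a \<in> R" "b \<in> R" "a * b = 1"
  shows "principal R a = R"
  using assms unfolding principal_def
  by (auto intro: mult_mem) (metis mult.assoc mult.left_neutral mult_mem)

lemma gen_ideal_1: "gen_ideal 1 = R"
  using ideal_pow_eq[OF ideal_in_R, of 0] by simp

lemma gen_ideal_power_principal:
  assumes "a \<in> R" "S \<subseteq> R" "gen_ideal S = principal R a"
  shows "gen_ideal (S ^ n) = principal R (a ^ n)"
proof (induction n)
  case 0
  show ?case using gen_ideal_1 principal_one_unit[of 1 1] one_mem by simp
next
  case (Suc n)
  then show ?case
    using gen_ideal_mult_principal[OF assms(1) power_mem[OF assms(1)] assms(2) set_power_subset[OF assms(2)] assms(3)]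
    by simp
qed

end

lemma set_power_intro: "(x::'a::comm_monoid_mult) \<in> S \<Longrightarrow> x ^ n \<in> S ^ n"
  by (induction n) auto

section \<open>Generated subfields of the complex numbers\<close>

lemma subfield_gen_field: "subfield_C (gen_field S)"
  unfolding gen_field_def subfield_C_def by blast

lemma gen_field_subset: "S \<subseteq> gen_field S"
  unfolding gen_field_def by blast

lemma gen_field_minimal: "S \<subseteq> gen_field T \<Longrightarrow> gen_field S \<subseteq> gen_field T"
  using subfield_gen_field[of T] unfolding gen_field_def[of S] by blast

lemma subfield_C_divide: "subfield_C F \<Longrightarrow> x \<in> F \<Longrightarrow> y \<in> F \<Longrightarrow> x / y \<in> F"
  unfolding subfield_C_def divide_inverse by (metis inverse_zero)

lemma subfield_C_subring: "subfield_C F \<Longrightarrow> complex_subring F"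
  by unfold_locales (auto simp: subfield_C_def)

lemmas subfield_C_power = complex_subring.power_mem[OF subfield_C_subring]

section \<open>Eisenstein integers\<close>

lemma zeta3_square: "zeta3 ^ 2 = - zeta3 - 1"
  by (simp add: zeta3_def complex_eq_iff power2_eq_square)

lemma zeta3_cube: "zeta3 ^ 3 = 1"
proof -
  have "zeta3 ^ 3 - 1 = (zeta3 - 1) * (zeta3 ^ 2 - (- zeta3 - 1))"
    by (simp add: algebra_simps power2_eq_square power3_eq_cube)
  then show ?thesis by (simp add: zeta3_square)
qed

lemma cnj_zeta3: "cnj zeta3 = zeta3 ^ 2"
  unfolding zeta3_square by (simp add: zeta3_def complex_eq_iff)

lemma zeta3_nonzero [simp]: "zeta3 \<noteq> 0"
  using zeta3_cube by auto

lemma sqrtm3_square: "sqrtm3 ^ 2 = - 3"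
proof -
  have "sqrtm3 ^ 2 + 3 = 4 * (zeta3 ^ 2 - (- zeta3 - 1))"
    by (simp add: algebra_simps power2_eq_square sqrtm3_def)
  then show ?thesis by (simp add: zeta3_square eq_neg_iff_add_eq_0)
qed

lemma sqrtm3_nonzero [simp]: "sqrtm3 \<noteq> 0"
  using sqrtm3_square by auto

lemma complex_of_rat_conv: "complex_of_rat q = complex_of_real (of_rat q)"
  by (cases q rule: Rat_cases) (simp add: of_rat_rat)

lemma of_rat_mem_kF: "of_rat a \<in> kF"
  unfolding kF_def by (rule CollectI, rule exI[of _ a], rule exI[of _ 0]) simp

interpretation kF: complex_subring kF
proof
  show "0 \<in> kF" "1 \<in> kF" using of_rat_mem_kF[of 0] of_rat_mem_kF[of 1] by simp_all
  fix x y assume "x \<in> kF" "y \<in> kF"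
  then obtain a b c d where xy: "x = of_rat a + of_rat b * zeta3" "y = of_rat c + of_rat d * zeta3"
    by (auto simp: kF_def)
  show "x + y \<in> kF" unfolding kF_def xy
    by (rule CollectI, rule exI[of _ "a + c"], rule exI[of _ "b + d"])
      (simp add: of_rat_add algebra_simps)
  show "x - y \<in> kF" unfolding kF_def xy
    by (rule CollectI, rule exI[of _ "a - c"], rule exI[of _ "b - d"])
      (simp add: of_rat_diff algebra_simps)
  have "x * y = of_rat a * of_rat c + (of_rat a * of_rat d + of_rat b * of_rat c) * zeta3
      + of_rat b * of_rat d * zeta3 ^ 2"
    unfolding xy by (simp add: algebra_simps power2_eq_square)
  also have "\<dots> = of_rat (a * c - b * d) + of_rat (a * d + b * c - b * d) * zeta3"
    unfolding zeta3_square by (simp add: of_rat_add of_rat_diff of_rat_mult algebra_simps)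
  finally show "x * y \<in> kF" unfolding kF_def by blast
qed

interpretation Ok: complex_subring Ok
proof
  show "0 \<in> Ok" unfolding Ok_def by (rule CollectI, rule exI[of _ 0], rule exI[of _ 0]) simp
  show "1 \<in> Ok" unfolding Ok_def by (rule CollectI, rule exI[of _ 1], rule exI[of _ 0]) simp
  fix x y assume "x \<in> Ok" "y \<in> Ok"
  then obtain a b c d where xy: "x = of_int a + of_int b * zeta3" "y = of_int c + of_int d * zeta3"
    by (auto simp: Ok_def)
  show "x + y \<in> Ok" unfolding Ok_def xy
    by (rule CollectI, rule exI[of _ "a + c"], rule exI[of _ "b + d"]) (simp add: algebra_simps)
  show "x - y \<in> Ok" unfolding Ok_def xy
    by (rule CollectI, rule exI[of _ "a - c"], rule exI[of _ "b - d"]) (simp add: algebra_simps)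
  have "x * y = of_int a * of_int c + (of_int a * of_int d + of_int b * of_int c) * zeta3
      + of_int b * of_int d * zeta3 ^ 2"
    unfolding xy by (simp add: algebra_simps power2_eq_square)
  also have "\<dots> = of_int (a * c - b * d) + of_int (a * d + b * c - b * d) * zeta3"
    unfolding zeta3_square by (simp add: algebra_simps)
  finally show "x * y \<in> Ok" unfolding Ok_def by blast
qed

lemma zeta3_mem_Ok: "zeta3 \<in> Ok"
  unfolding Ok_def by (rule CollectI, rule exI[of _ 0], rule exI[of _ 1]) simp

lemma sqrtm3_mem_Ok: "sqrtm3 \<in> Ok"
  unfolding sqrtm3_def by (intro Ok.closed zeta3_mem_Ok)

lemma Ok_subset_kF: "Ok \<subseteq> kF"
proof
  fix x assume "x \<in> Ok"
  then obtain a b where "x = of_int a + of_int b * zeta3" by (auto simp: Ok_def)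
  then show "x \<in> kF" unfolding kF_def
    by (intro CollectI exI[of _ "of_int a"] exI[of _ "of_int b"]) simp
qed

lemma kF_fraction:
  assumes "x \<in> kF"
  obtains n :: int where "n \<noteq> 0" "of_int n * x \<in> Ok"
proof -
  obtain a b where x: "x = of_rat a + of_rat b * zeta3" using assms by (auto simp: kF_def)
  obtain p q where a: "a = of_int p / of_int q" "q > 0"
    by (cases a rule: Rat_cases) (auto simp: Fract_of_int_quotient)
  obtain r s where b: "b = of_int r / of_int s" "s > 0"
    by (cases b rule: Rat_cases) (auto simp: Fract_of_int_quotient)
  have "of_int (q * s) * x = of_int (s * p) + of_int (q * r) * zeta3"
  proof -
    have "complex_of_int q \<noteq> 0" "complex_of_int s \<noteq> 0" using a(2) b(2) by simp_all
    moreover have "x = of_int p / of_int q + of_int r / of_int s * zeta3"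
      by (simp add: x a(1) b(1) of_rat_divide)
    ultimately show ?thesis by (simp add: field_simps)
  qed
  hence "of_int (q * s) * x \<in> Ok" unfolding Ok_def by blast
  then show ?thesis using a b by (intro that[of "q * s"]) auto
qed

lemma norm_zeta3_form:
  "(of_rat a + of_rat b * zeta3) * (of_rat a + of_rat b * zeta3 ^ 2)
    = complex_of_rat (a ^ 2 - a * b + b ^ 2)" (is "?l = ?r")
proof -
  have "?l = of_rat a ^ 2 + of_rat a * of_rat b * (zeta3 + zeta3 ^ 2) + of_rat b ^ 2 * zeta3 ^ 3"
    by (simp add: algebra_simps power2_eq_square power3_eq_cube)
  also have "\<dots> = ?r"
    by (simp add: zeta3_square zeta3_cube of_rat_add of_rat_diff of_rat_mult of_rat_power)
  finally show ?thesis .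
qed

lemma kF_conj:
  assumes "x \<in> kF"
  obtains r where "cnj x \<in> kF" "x * cnj x = of_rat r"
proof -
  obtain a b where x: "x = of_rat a + of_rat b * zeta3" using assms by (auto simp: kF_def)
  have rr: "cnj (of_rat q) = of_rat q" for q
    by (simp add: complex_of_rat_conv)
  have c: "cnj x = of_rat a + of_rat b * zeta3 ^ 2" by (simp add: x cnj_zeta3 rr)
  have "cnj x \<in> kF" unfolding c
    by (intro kF.closed of_rat_mem_kF subsetD[OF Ok_subset_kF] zeta3_mem_Ok)
  moreover have "x * cnj x = of_rat (a ^ 2 - a * b + b ^ 2)"
    unfolding c unfolding x by (rule norm_zeta3_form)
  ultimately show ?thesis by (rule that)
qed

lemma inverse_mem_kF:
  assumes "x \<in> kF"
  shows "inverse x \<in> kF"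
proof (cases "x = 0")
  case False
  obtain r where r: "cnj x \<in> kF" "x * cnj x = of_rat r" using kF_conj[OF assms] .
  have "inverse x = cnj x * of_rat (inverse r)"
    unfolding of_rat_inverse r(2)[symmetric] using False by simp
  then show ?thesis using r(1) by (simp add: kF.mult_mem of_rat_mem_kF)
qed (simp add: kF.zero_mem)

lemma divide_mem_kF: "x \<in> kF \<Longrightarrow> y \<in> kF \<Longrightarrow> x / y \<in> kF"
  by (simp add: divide_inverse kF.mult_mem inverse_mem_kF)

lemma cube_eq_imp_zeta3:
  assumes "x ^ 3 = y ^ 3"
  obtains i where "x = zeta3 ^ i * y"
proof -
  \<comment> \<open>The identity holds with an indeterminate in place of \<open>zeta3\<close>; the
    error term carries the factor 1 + \<open>zeta3\<close> + \<open>zeta3\<close>^2, which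
    vanishes.\<close>
  have "(x - y) * (x - zeta3 * y) * (x - zeta3 ^ 2 * y)
      = x ^ 3 - zeta3 ^ 3 * y ^ 3 - (1 + zeta3 + zeta3 ^ 2) * (x ^ 2 * y - zeta3 * x * y ^ 2)"
    by (simp add: algebra_simps power2_eq_square power3_eq_cube)
  also have "\<dots> = 0" using assms by (simp add: zeta3_square zeta3_cube)
  finally have "x = zeta3 ^ 0 * y \<or> x = zeta3 ^ 1 * y \<or> x = zeta3 ^ 2 * y" by simp
  then show ?thesis using that by blast
qed

section \<open>Euclidean division, Bezout identities and primes in the Eisenstein integers\<close>

definition eis_norm :: "complex \<Rightarrow> nat" where
  "eis_norm x = nat \<lfloor>(cmod x)\<^sup>2\<rfloor>"

lemma cmod_square_zeta3: "(cmod (of_real a + of_real b * zeta3))\<^sup>2 = a ^ 2 - a * b + b ^ 2"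
proof -
  have "(cmod (of_real a + of_real b * zeta3))\<^sup>2 = (a - b / 2)\<^sup>2 + (b * sqrt 3 / 2)\<^sup>2"
    by (simp add: zeta3_def cmod_def)
  also have "\<dots> = a ^ 2 - a * b + b ^ 2"
    by (simp add: power_mult_distrib power_divide) (simp add: power2_eq_square field_simps)
  finally show ?thesis .
qed

lemma of_nat_eis_norm:
  assumes "x \<in> Ok"
  shows "real (eis_norm x) = (cmod x)\<^sup>2"
proof -
  obtain a b where "x = of_int a + of_int b * zeta3" using assms by (auto simp: Ok_def)
  \<comment> \<open>The squared modulus is an integer on \<open>Ok\<close>, so the floor in
    \<open>eis_norm\<close> loses nothing there.\<close>
  hence "(cmod x)\<^sup>2 = of_int (a ^ 2 - a * b + b ^ 2)"
    using cmod_square_zeta3[of "of_int a" "of_int b"] by simp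
  moreover have "0 \<le> (cmod x)\<^sup>2" by simp
  ultimately show ?thesis unfolding eis_norm_def
    by (metis floor_of_int int_nat_eq of_int_0_le_iff of_int_of_nat_eq)
qed

lemma eis_norm_mult: "x \<in> Ok \<Longrightarrow> y \<in> Ok \<Longrightarrow> eis_norm (x * y) = eis_norm x * eis_norm y"
  by (subst of_nat_eq_iff[where 'a = real, symmetric])
    (simp add: of_nat_eis_norm Ok.mult_mem norm_mult power_mult_distrib)

lemma eis_norm_eq_0: "x \<in> Ok \<Longrightarrow> eis_norm x = 0 \<longleftrightarrow> x = 0"
  using of_nat_eis_norm[of x] by auto

lemma eis_norm_1: "eis_norm 1 = 1"
  by (simp add: eis_norm_def)

lemma eis_norm_eq_1_cases:
  assumes "x \<in> Ok" "eis_norm x = 1"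
  obtains i where "i < (3::nat)" "x = zeta3 ^ i \<or> x = - (zeta3 ^ i)"
proof -
  obtain a b where x: "x = of_int a + of_int b * zeta3" using assms by (auto simp: Ok_def)
  have "real_of_int (a ^ 2 - a * b + b ^ 2) = 1"
    using cmod_square_zeta3[of "of_int a" "of_int b"] of_nat_eis_norm[OF assms(1)] assms(2)
    by (simp add: x)
  hence eq: "a ^ 2 - a * b + b ^ 2 = 1" by linarith
  \<comment> \<open>Completing the square in either variable bounds the other one, which leaves nine
    pairs to inspect.\<close>
  have "(2 * a - b)^2 + 3 * b^2 = 4" "(2 * b - a)^2 + 3 * a^2 = 4"
    using eq by (simp_all add: power2_eq_square algebra_simps)
  hence "3 * b ^ 2 \<le> 4" "3 * a ^ 2 \<le> 4"
    by (metis add.commute le_add_same_cancel1 zero_le_power2)+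
  hence "\<bar>b\<bar> < 2" "\<bar>a\<bar> < 2"
    using abs_le_square_iff[of 2 b] abs_le_square_iff[of 2 a] by simp_all
  hence "a \<in> {-1,0,1}" "b \<in> {-1,0,1}" by auto
  with eq consider "a = 1" "b = 0" | "a = -1" "b = 0" | "a = 0" "b = 1" | "a = 0" "b = -1"
    | "a = 1" "b = 1" | "a = -1" "b = -1" by auto
  then show ?thesis
  proof cases
    case 1 then show ?thesis using that[of 0] by (simp add: x)
  next
    case 2 then show ?thesis using that[of 0] by (simp add: x)
  next
    case 3 then show ?thesis using that[of 1] by (simp add: x)
  next
    case 4 then show ?thesis using that[of 1] by (simp add: x)
  next
    case 5 then show ?thesis using that[of 2] by (simp add: x zeta3_square)
  next
    case 6 then show ?thesis using that[of 2] by (simp add: x zeta3_square)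
  qed
qed

lemma eis_unit_iff:
  assumes "x \<in> Ok"
  shows "(\<exists>u\<in>Ok. x * u = 1) \<longleftrightarrow> eis_norm x = 1"
proof
  assume "\<exists>u\<in>Ok. x * u = 1"
  then obtain u where "u \<in> Ok" "x * u = 1" by blast
  hence "eis_norm x * eis_norm u = 1" using eis_norm_mult[OF assms] eis_norm_1 by metis
  then show "eis_norm x = 1" by simp
next
  assume "eis_norm x = 1"
  then obtain i where i: "i < (3::nat)" "x = zeta3 ^ i \<or> x = - (zeta3 ^ i)"
    using eis_norm_eq_1_cases[OF assms] by metis
  have "zeta3 ^ i * zeta3 ^ (3 - i) = 1"
    using i(1) zeta3_cube by (simp flip: power_add)
  moreover have "zeta3 ^ (3 - i) \<in> Ok" by (intro Ok.closed zeta3_mem_Ok)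
  ultimately show "\<exists>u\<in>Ok. x * u = 1"
    using i(2) Ok.minus_mem by (metis minus_mult_minus)
qed

lemma eis_division:
  assumes "a \<in> Ok" "b \<in> Ok" "b \<noteq> 0"
  obtains q where "q \<in> Ok" "eis_norm (a - b * q) < eis_norm b"
proof -
  have "a / b \<in> kF" using assms Ok_subset_kF by (intro divide_mem_kF) auto
  then obtain r s where rs: "a / b = of_rat r + of_rat s * zeta3" by (auto simp: kF_def)
  define q where "q = of_int (round r) + of_int (round s) * zeta3"
  define e f where "e = real_of_rat (r - of_int (round r))" and "f = real_of_rat (s - of_int (round s))"
  have q: "q \<in> Ok" unfolding q_def Ok_def by blast
  have half: "\<bar>real_of_rat (t - of_int (round t))\<bar> \<le> 1 / 2" for t :: rat
  proof -
    have "\<bar>t - of_int (round t)\<bar> \<le> 1 / 2"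
      using of_int_round_abs_le[of t] by (simp add: abs_minus_commute)
    hence "real_of_rat \<bar>t - of_int (round t)\<bar> \<le> real_of_rat (1 / 2)"
      unfolding of_rat_less_eq .
    then show ?thesis by (simp add: of_rat_divide)
  qed
  have ef: "\<bar>e\<bar> \<le> 1 / 2" "\<bar>f\<bar> \<le> 1 / 2" unfolding e_def f_def by (rule half)+
  have "a / b - q = of_real e + of_real f * zeta3"
    unfolding rs q_def e_def f_def complex_of_rat_conv[symmetric] by (simp add: of_rat_diff algebra_simps)
  hence "(cmod (a / b - q))\<^sup>2 = e ^ 2 - e * f + f ^ 2" by (simp add: cmod_square_zeta3)
  \<comment> \<open>Rounding both coordinates leaves errors of at most 1/2, so the norm form is at
    most 3/4.\<close>
  also have "\<dots> < 1"
  proof -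
    have "e ^ 2 \<le> (1/2)^2" "f ^ 2 \<le> (1/2)^2" "\<bar>e\<bar> * \<bar>f\<bar> \<le> 1/2 * (1/2)"
      using ef mult_mono[of "\<bar>e\<bar>" "1/2" "\<bar>f\<bar>" "1/2"] by (auto simp: abs_le_square_iff[symmetric])
    moreover have "- (e * f) \<le> \<bar>e\<bar> * \<bar>f\<bar>" by (metis abs_ge_minus_self abs_mult)
    ultimately have "e ^ 2 - e * f + f ^ 2 \<le> 3 / 4" by (simp add: power2_eq_square)
    then show ?thesis by simp
  qed
  finally have "(cmod (a / b - q))\<^sup>2 * (cmod b)\<^sup>2 < (cmod b)\<^sup>2"
    using assms(3) by simp
  moreover have "(a / b - q) * b = a - b * q" using assms(3) by (simp add: field_simps)
  ultimately have "(cmod (a - b * q))\<^sup>2 < (cmod b)\<^sup>2"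
    by (metis norm_mult power_mult_distrib)
  hence "real (eis_norm (a - b * q)) < real (eis_norm b)"
    using assms q by (simp add: of_nat_eis_norm Ok.closed)
  then show ?thesis using that[OF q] by simp
qed

text \<open>A nonzero element of least norm in the ideal generated by \<open>a\<close> and
  \<open>b\<close> divides every element of that ideal, because remainders stay inside it.\<close>

lemma eis_bezout:
  assumes "a \<in> Ok" "b \<in> Ok" "b \<noteq> 0"
  obtains u v where "u \<in> Ok" "v \<in> Ok" "dvd_in Ok (a * u + b * v) a" "dvd_in Ok (a * u + b * v) b"
    "a * u + b * v \<noteq> 0"
proof -
  define I where "I = {a * u + b * v | u v. u \<in> Ok \<and> v \<in> Ok}"
  have "b \<in> I"
    unfolding I_def by (rule CollectI, rule exI[of _ 0], rule exI[of _ 1]) (simp add: Ok.closed)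
  hence "\<exists>d. d \<in> I \<and> d \<noteq> 0" using assms by blast
  then obtain d where d: "d \<in> I" "d \<noteq> 0"
    and min: "\<And>e. e \<in> I \<Longrightarrow> e \<noteq> 0 \<Longrightarrow> eis_norm d \<le> eis_norm e"
    using exists_least_iff[of "\<lambda>n. \<exists>d. d \<in> I \<and> d \<noteq> 0 \<and> eis_norm d = n"]
    by (metis (mono_tags, lifting) linorder_le_less_linear)
  have IOk: "e \<in> Ok" if "e \<in> I" for e using that assms by (auto simp: I_def intro!: Ok.closed)
  have dvd: "dvd_in Ok d e" if e: "e \<in> I" for e
  proof -
    obtain q where q: "q \<in> Ok" "eis_norm (e - d * q) < eis_norm d"
      using eis_division[OF IOk[OF e] IOk[OF d(1)] d(2)] .
    obtain u v u' v' where uv: "u \<in> Ok" "v \<in> Ok" "u' \<in> Ok" "v' \<in> Ok"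
      "e = a * u + b * v" "d = a * u' + b * v'" using e d(1) by (auto simp: I_def)
    have "e - d * q = a * (u - u' * q) + b * (v - v' * q)" by (simp add: uv algebra_simps)
    hence "e - d * q \<in> I" unfolding I_def using uv q
      by (intro CollectI exI[of _ "u - u' * q"] exI[of _ "v - v' * q"]) (auto intro!: Ok.closed)
    hence "e - d * q = 0" using min q(2) by fastforce
    then show ?thesis using q(1) by (auto simp: dvd_in_def)
  qed
  have "a \<in> I"
    unfolding I_def by (rule CollectI, rule exI[of _ 1], rule exI[of _ 0]) (simp add: Ok.closed)
  obtain u v where uv: "u \<in> Ok" "v \<in> Ok" "d = a * u + b * v" using d(1) by (auto simp: I_def)
  show ?thesis
    using dvd[OF \<open>a \<in> I\<close>] dvd[OF \<open>b \<in> I\<close>] d(2) unfolding uv(3) by (rule that[OF uv(1,2)])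
qed

text \<open>The Bezout combination divides the prime \<open>q\<close>, so it is a unit or associated
  to \<open>q\<close>; the latter would make \<open>q\<close> divide \<open>a\<close>.\<close>

lemma prime_bezout:
  assumes q: "prime_elem_in Ok q" and a: "a \<in> Ok" "\<not> dvd_in Ok q a"
  obtains u v where "u \<in> Ok" "v \<in> Ok" "a * u + q * v = 1"
proof -
  have qOk: "q \<in> Ok" "q \<noteq> 0" using q by (auto simp: prime_elem_in_def)
  obtain u v where uv: "u \<in> Ok" "v \<in> Ok" "dvd_in Ok (a * u + q * v) a"
    "dvd_in Ok (a * u + q * v) q" "a * u + q * v \<noteq> 0"
    using eis_bezout[OF a(1) qOk] .
  define d where "d = a * u + q * v"
  have dOk: "d \<in> Ok" unfolding d_def using uv a qOk by (intro Ok.closed)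
  obtain e where e: "e \<in> Ok" "q = d * e" using uv(4) by (auto simp: dvd_in_def d_def)
  have "dvd_in Ok q d \<or> dvd_in Ok q e"
    using q e dOk Ok.dvd_in_refl by (metis prime_elem_in_def)
  moreover have "\<not> dvd_in Ok q d"
    using uv(3) a(2) Ok.dvd_in_trans unfolding d_def by blast
  ultimately obtain f where f: "f \<in> Ok" "e = q * f" by (auto simp: dvd_in_def)
  hence "d * f = 1" using e qOk by (metis mult.assoc mult.commute mult_cancel_left1)
  hence "a * (u * f) + q * (v * f) = 1" unfolding d_def by (simp add: algebra_simps)
  then show ?thesis using that uv f by (metis Ok.mult_mem)
qed

lemma eis_prime_dvd_mult:
  "prime_elem_in Ok q \<Longrightarrow> a \<in> Ok \<Longrightarrow> b \<in> Ok \<Longrightarrow> dvd_in Ok q (a * b) \<Longrightarrow> dvd_in Ok q a \<or> dvd_in Ok q b"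
  by (auto simp: prime_elem_in_def)

lemma prime_not_dvd_1: "prime_elem_in Ok q \<Longrightarrow> \<not> dvd_in Ok q 1"
  by (metis dvd_in_def prime_elem_in_def)

lemma eis_prime_dvd_power:
  "prime_elem_in Ok q \<Longrightarrow> a \<in> Ok \<Longrightarrow> dvd_in Ok q (a ^ n) \<Longrightarrow> dvd_in Ok q a"
  by (induction n) (auto dest: eis_prime_dvd_mult prime_not_dvd_1 intro: Ok.power_mem)

lemma prime_eis_norm:
  assumes "prime_elem_in Ok q"
  shows "2 \<le> eis_norm q"
proof -
  have "eis_norm q \<noteq> 0" "eis_norm q \<noteq> 1"
    using assms eis_unit_iff[of q] eis_norm_eq_0[of q] unfolding prime_elem_in_def by blast+
  then show ?thesis by simp
qed

text \<open>A nonunit divisor \<open>q\<close> of least norm is prime: by minimality, the greatest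
  common divisor of \<open>a\<close> and \<open>q\<close> is either a unit, and then Bezout gives
  the second divisibility, or associated to \<open>q\<close>.\<close>

lemma prime_divisor_exists:
  assumes "m \<in> Ok" "m \<noteq> 0" "eis_norm m \<noteq> 1"
  obtains q where "prime_elem_in Ok q" "dvd_in Ok q m"
proof -
  define D where "D q \<longleftrightarrow> q \<in> Ok \<and> dvd_in Ok q m \<and> eis_norm q \<noteq> 1" for q
  have "D m" using assms by (auto simp: D_def Ok.dvd_in_refl)
  then obtain q where q: "D q" and min: "\<And>d. D d \<Longrightarrow> eis_norm q \<le> eis_norm d"
    using exists_least_iff[of "\<lambda>n. \<exists>d. D d \<and> eis_norm d = n"]
    by (metis (mono_tags, lifting) linorder_le_less_linear)
  have qOk: "q \<in> Ok" "dvd_in Ok q m" "eis_norm q \<noteq> 1" using q by (auto simp: D_def)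
  have q0: "q \<noteq> 0" using qOk(2) assms(2) by (auto simp: dvd_in_def)
  have "dvd_in Ok q b" if ab: "a \<in> Ok" "b \<in> Ok" "dvd_in Ok q (a * b)" "\<not> dvd_in Ok q a" for a b
  proof -
    obtain u v where uv: "u \<in> Ok" "v \<in> Ok" "dvd_in Ok (a * u + q * v) a"
      "dvd_in Ok (a * u + q * v) q" using eis_bezout[OF ab(1) qOk(1) q0] .
    define d where "d = a * u + q * v"
    have dOk: "d \<in> Ok" unfolding d_def using uv ab qOk by (intro Ok.closed)
    obtain e where e: "e \<in> Ok" "q = d * e" using uv(4) by (auto simp: dvd_in_def d_def)
    have "eis_norm d = 1"
    proof (rule ccontr)
      assume "eis_norm d \<noteq> 1"
      hence "D d" using dOk uv(4) qOk(2) Ok.dvd_in_trans unfolding D_def d_def by blast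
      hence "eis_norm d * eis_norm e \<le> eis_norm d"
        using min e eis_norm_mult[OF dOk e(1)] by metis
      moreover have "eis_norm d \<noteq> 0" "eis_norm e \<noteq> 0"
        using q0 e dOk by (auto simp: eis_norm_eq_0)
      ultimately have "eis_norm e = 1" by simp
      then obtain f where "f \<in> Ok" "e * f = 1" using eis_unit_iff[OF e(1)] by blast
      hence "dvd_in Ok q d" using e(2) by (intro Ok.dvd_inI[of f]) (simp_all add: mult.assoc)
      then show False using uv(3) ab(4) Ok.dvd_in_trans unfolding d_def by blast
    qed
    then obtain f where f: "f \<in> Ok" "d * f = 1" using eis_unit_iff[OF dOk] by blast
    have "b = a * b * (u * f) + q * (v * f * b)"
    proof -
      have "b = b * (d * f)" by (simp add: f(2))
      then show ?thesis unfolding d_def by (simp add: algebra_simps)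
    qed
    then show ?thesis
      using ab uv f by (metis Ok.dvd_in_add Ok.dvd_in_mult_right Ok.dvd_in_self Ok.mult_mem)
  qed
  hence "prime_elem_in Ok q"
    unfolding prime_elem_in_def using qOk q0 eis_unit_iff by blast
  then show ?thesis using that qOk by blast
qed

section \<open>The prime sqrt(-3) above 3\<close>

lemma sqrtm3_zeta3: "zeta3 - 1 = sqrtm3 * (- (zeta3 ^ 2))" "zeta3 ^ 2 - 1 = sqrtm3 * zeta3"
proof -
  have "sqrtm3 * (- (zeta3 ^ 2)) = - 2 * zeta3 ^ 3 - zeta3 ^ 2" "sqrtm3 * zeta3 = 2 * zeta3 ^ 2 + zeta3"
    by (simp_all add: sqrtm3_def power2_eq_square power3_eq_cube algebra_simps)
  then show "zeta3 - 1 = sqrtm3 * (- (zeta3 ^ 2))" "zeta3 ^ 2 - 1 = sqrtm3 * zeta3"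
    by (simp_all add: zeta3_cube zeta3_square)
qed

lemma eis_norm_sqrtm3: "eis_norm sqrtm3 = 3"
proof -
  have "cmod sqrtm3 ^ 2 = 3" by (metis norm_minus_cancel norm_numeral norm_power sqrtm3_square)
  then show ?thesis by (simp add: eis_norm_def)
qed

text \<open>Since \<open>zeta3\<close> is 1 modulo sqrt(-3), every Eisenstein integer is congruent
  to the sum of its coordinates; as sqrt(-3) divides 3, only the residues 0, 1 and -1
  remain.\<close>

lemma residue_mod_sqrtm3:
  assumes "a \<in> Ok" "\<not> dvd_in Ok sqrtm3 a"
  shows "dvd_in Ok sqrtm3 (a - 1) \<or> dvd_in Ok sqrtm3 (a + 1)"
proof -
  obtain c d where a: "a = of_int c + of_int d * zeta3" using assms by (auto simp: Ok_def)
  have three: "dvd_in Ok sqrtm3 (of_int (3 * k))" for k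
  proof (rule Ok.dvd_inI)
    show "of_int (3 * k) = sqrtm3 * (- sqrtm3 * of_int k)"
      using sqrtm3_square by (simp add: power2_eq_square flip: mult.assoc)
  qed (intro Ok.closed sqrtm3_mem_Ok)
  have "a - of_int (c + d) = of_int d * (zeta3 - 1)" by (simp add: a algebra_simps)
  hence base: "dvd_in Ok sqrtm3 (a - of_int (c + d))"
    unfolding sqrtm3_zeta3(1)
    by (metis Ok.dvd_in_mult_left Ok.dvd_in_self Ok.minus_mem Ok.of_int_mem Ok.power_mem zeta3_mem_Ok)
  have red: "dvd_in Ok sqrtm3 (a - of_int r)" if "(c + d) mod 3 = r mod 3" for r
  proof -
    have "3 dvd c + d - r" using that by (simp add: mod_eq_dvd_iff)
    then obtain k where "c + d - r = 3 * k" ..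
    hence "r = (c + d) - 3 * k" by linarith
    hence "complex_of_int r = of_int (c + d) - of_int (3 * k)" by (simp only: of_int_diff)
    hence "a - of_int r = (a - of_int (c + d)) + of_int (3 * k)" by simp
    then show ?thesis using base three Ok.dvd_in_add by metis
  qed
  consider "(c + d) mod 3 = 0" | "(c + d) mod 3 = 1 mod 3" | "(c + d) mod 3 = (-1) mod 3" by force
  then show ?thesis
    using red[of 0] red[of 1] red[of "-1"] assms(2) by cases auto
qed

lemma prime_sqrtm3: "prime_elem_in Ok sqrtm3"
  unfolding prime_elem_in_def
proof (intro conjI ballI impI)
  show "\<not> (\<exists>u\<in>Ok. sqrtm3 * u = 1)"
    using eis_unit_iff[OF sqrtm3_mem_Ok] eis_norm_sqrtm3 by simp
  fix a b assume ab: "a \<in> Ok" "b \<in> Ok" "dvd_in Ok sqrtm3 (a * b)"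
  show "dvd_in Ok sqrtm3 a \<or> dvd_in Ok sqrtm3 b"
  proof (cases "dvd_in Ok sqrtm3 a")
    case False
    then consider "dvd_in Ok sqrtm3 (a - 1)" | "dvd_in Ok sqrtm3 (a + 1)"
      using residue_mod_sqrtm3 ab by blast
    then have "dvd_in Ok sqrtm3 b"
    proof cases
      case 1
      have "b = a * b - (a - 1) * b" by (simp add: algebra_simps)
      then show ?thesis using ab 1 by (metis Ok.dvd_in_diff Ok.dvd_in_mult_right)
    next
      case 2
      have "b = (a + 1) * b - a * b" by (simp add: algebra_simps)
      then show ?thesis using ab 2 by (metis Ok.dvd_in_diff Ok.dvd_in_mult_right)
    qed
    then show ?thesis ..
  qed simp
qed (simp_all add: sqrtm3_mem_Ok)

lemma prime_dvd_3_associated: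
  assumes q: "prime_elem_in Ok q" and "dvd_in Ok q 3"
  shows "dvd_in Ok q sqrtm3" "dvd_in Ok sqrtm3 q"
proof -
  have qOk: "q \<in> Ok" using q by (simp add: prime_elem_in_def)
  have "dvd_in Ok q (sqrtm3 ^ 2)"
    using assms(2) Ok.dvd_in_uminus unfolding sqrtm3_square by blast
  then show 1: "dvd_in Ok q sqrtm3" by (rule eis_prime_dvd_power[OF q sqrtm3_mem_Ok])
  show "dvd_in Ok sqrtm3 q"
  proof (rule ccontr)
    assume "\<not> dvd_in Ok sqrtm3 q"
    then obtain u v where "u \<in> Ok" "v \<in> Ok" "q * u + sqrtm3 * v = 1"
      using prime_bezout[OF prime_sqrtm3 qOk] by metis
    hence "dvd_in Ok q 1"
      using 1 by (metis Ok.dvd_in_add Ok.dvd_in_self Ok.dvd_in_mult_right)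
    then show False using prime_not_dvd_1[OF q] by simp
  qed
qed

section \<open>Integral elements of the base field\<close>

lemma alg_int_Ok:
  assumes "x \<in> Ok"
  shows "alg_int x"
proof -
  obtain a b where x: "x = of_int a + of_int b * zeta3" using assms by (auto simp: Ok_def)
  have "alg_int zeta3" by (rule alg_int_cube_root) (use alg_int_of_int[of 1] in \<open>simp add: zeta3_cube\<close>)
  then show ?thesis unfolding x by (intro alg_int_add_mult alg_int_of_int)
qed

text \<open>The trace 2a - b, the number -3b = sqrt(-3) (x - cnj x) and the norm are rational and
  integral, hence integers A, B, C. Eliminating a and b gives 3A^2 + B^2 = 12C: modulo 3 this makes
  b an integer, and then parity does the same for a.\<close>

lemma alg_int_kF:
  assumes "x \<in> kF" "alg_int x"
  shows "x \<in> Ok"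
proof -
  obtain a b where x: "x = of_rat a + of_rat b * zeta3" using assms by (auto simp: kF_def)
  have rr: "cnj (of_rat q) = of_rat q" for q
    by (simp add: complex_of_rat_conv)
  have c: "cnj x = of_rat a + of_rat b * (- zeta3 - 1)" by (simp add: x cnj_zeta3 rr flip: zeta3_square)
  have rat_int: "\<exists>n. q = of_int n" if "alg_int (of_rat q)" for q
  proof -
    have "complex_of_rat q \<in> \<int>"
      using that rational_algebraic_int_is_int[of "complex_of_rat q"]
      by (simp add: alg_int_iff_algebraic_int)
    then obtain n where "complex_of_rat q = of_int n" by (auto elim: Ints_cases)
    hence "q = of_int n" by (metis of_rat_eq_iff of_rat_of_int_eq)
    then show ?thesis ..
  qed
  have ic: "alg_int (cnj x)" by (rule alg_int_cnj) fact
  have "x + cnj x = of_rat (2 * a - b)"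
    unfolding c unfolding x by (simp add: of_rat_add of_rat_diff of_rat_mult algebra_simps)
  then obtain A where A: "2 * a - b = of_int A" using rat_int alg_int_add_mult(1)[OF assms(2) ic] by metis
  have "(x - cnj x) * sqrtm3 = of_rat b * sqrtm3 ^ 2"
    unfolding c unfolding x sqrtm3_def by (simp add: power2_eq_square algebra_simps)
  also have "\<dots> = of_rat (- 3 * b)" by (simp add: sqrtm3_square of_rat_mult of_rat_minus)
  finally obtain B where B: "- 3 * b = of_int B"
    using rat_int alg_int_add_mult(2)[OF alg_int_diff[OF assms(2) ic] alg_int_Ok[OF sqrtm3_mem_Ok]] by metis
  have "x * cnj x = of_rat (a ^ 2 - a * b + b ^ 2)"
    unfolding c unfolding x using norm_zeta3_form[of a b] by (simp add: zeta3_square)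
  then obtain C where C: "a ^ 2 - a * b + b ^ 2 = of_int C"
    using rat_int alg_int_add_mult(2)[OF assms(2) ic] by metis
  have "(2 * a - b) ^ 2 * 3 + (- 3 * b) ^ 2 = 12 * (a ^ 2 - a * b + b ^ 2)"
    by (simp add: power2_eq_square algebra_simps)
  hence "rat_of_int (A ^ 2 * 3 + B ^ 2) = of_int (12 * C)" unfolding A B C by simp
  hence eq: "A ^ 2 * 3 + B ^ 2 = 12 * C" by linarith
  hence "3 dvd B ^ 2" by presburger
  hence "3 dvd B" using prime_dvd_power[of "3::int" B 2] by simp
  then obtain b0 where "B = 3 * b0" ..
  moreover define b' where "b' = - b0"
  ultimately have b': "B = - 3 * b'" by simp
  have b: "b = of_int b'" using B b' by simp
  have "A ^ 2 + 3 * b' ^ 2 = 4 * C" using eq b' by (simp add: power2_eq_square)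
  hence "even (A ^ 2 + 3 * b' ^ 2)" by simp
  hence "even (A + b')" by simp
  then obtain a' where "A + b' = 2 * a'" ..
  hence "2 * a = of_int (2 * a')" using A b by (metis diff_add_cancel of_int_add)
  hence "a = of_int a'" by simp
  with b x show ?thesis unfolding Ok_def by auto
qed

lemma dvd_in_Ok_if_alg_int:
  assumes "a \<in> Ok" "b \<in> Ok" "alg_int x" "b = a * x"
  shows "dvd_in Ok a b"
proof (cases "a = 0")
  case True
  then show ?thesis using assms by (simp add: Ok.dvd_in_0)
next
  case False
  hence "x = b / a" using assms by simp
  hence "x \<in> kF" using assms Ok_subset_kF divide_mem_kF by blast
  then show ?thesis using assms alg_int_kF by (auto simp: dvd_in_def)
qed

section \<open>The cyclic cubic extension\<close>

locale cubic_extension =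
  fixes \<rho> \<pi> :: complex and \<tau> :: "complex \<Rightarrow> complex"
  assumes prime_pi: "prime_elem_in Ok \<pi>"
    and pi_cong_1: "cong_in Ok (3 * sqrtm3) \<pi> 1"
    and rho_cube: "\<rho> ^ 3 = \<pi>"
    and tau_add: "\<And>x y. x \<in> K1 \<rho> \<Longrightarrow> y \<in> K1 \<rho> \<Longrightarrow> \<tau> (x + y) = \<tau> x + \<tau> y"
    and tau_mult: "\<And>x y. x \<in> K1 \<rho> \<Longrightarrow> y \<in> K1 \<rho> \<Longrightarrow> \<tau> (x * y) = \<tau> x * \<tau> y"
    and tau_k: "\<And>c. c \<in> kF \<Longrightarrow> \<tau> c = c"
    and tau_rho: "\<tau> \<rho> = zeta3 * \<rho>"
begin

abbreviation "K \<equiv> K1 \<rho>"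
abbreviation "\<O> \<equiv> OK1 \<rho>"

lemma pi_mem_Ok: "\<pi> \<in> Ok" and pi_nonzero: "\<pi> \<noteq> 0"
  using prime_pi by (auto simp: prime_elem_in_def)

lemma Ok_kF: "c \<in> Ok \<Longrightarrow> c \<in> kF"
  using Ok_subset_kF by blast

lemma pi_mem_kF: "\<pi> \<in> kF"
  by (rule Ok_kF[OF pi_mem_Ok])

lemma K_I: "c0 \<in> kF \<Longrightarrow> c1 \<in> kF \<Longrightarrow> c2 \<in> kF \<Longrightarrow> c0 + c1 * \<rho> + c2 * \<rho> ^ 2 \<in> K"
  unfolding K1_def by blast

lemma K_E:
  assumes "x \<in> K"
  obtains c0 c1 c2 where "c0 \<in> kF" "c1 \<in> kF" "c2 \<in> kF" "x = c0 + c1 * \<rho> + c2 * \<rho> ^ 2"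
  using assms unfolding K1_def by blast

lemma kF_mem_K: "c \<in> kF \<Longrightarrow> c \<in> K"
  using K_I[of c 0 0] kF.zero_mem by simp

lemma rho_mem_K: "\<rho> \<in> K"
  using K_I[of 0 1 0] kF.zero_mem kF.one_mem by simp

lemma coords_mult:
  "(c0 + c1 * \<rho> + c2 * \<rho> ^ 2) * (d0 + d1 * \<rho> + d2 * \<rho> ^ 2) =
    (c0 * d0 + \<pi> * (c1 * d2 + c2 * d1)) + (c0 * d1 + c1 * d0 + \<pi> * c2 * d2) * \<rho>
      + (c0 * d2 + c1 * d1 + c2 * d0) * \<rho> ^ 2"
  unfolding rho_cube[symmetric] by (simp add: algebra_simps power2_eq_square power3_eq_cube)

sublocale K: complex_subring K
proof
  show "0 \<in> K" "1 \<in> K" by (intro kF_mem_K kF.closed)+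
  fix x y assume "x \<in> K" "y \<in> K"
  then obtain c0 c1 c2 d0 d1 d2 where
    c: "c0 \<in> kF" "c1 \<in> kF" "c2 \<in> kF" "x = c0 + c1 * \<rho> + c2 * \<rho> ^ 2" and
    d: "d0 \<in> kF" "d1 \<in> kF" "d2 \<in> kF" "y = d0 + d1 * \<rho> + d2 * \<rho> ^ 2"
    by (elim K_E)
  have sum: "x + y = (c0 + d0) + (c1 + d1) * \<rho> + (c2 + d2) * \<rho> ^ 2"
    and diff: "x - y = (c0 - d0) + (c1 - d1) * \<rho> + (c2 - d2) * \<rho> ^ 2"
    unfolding c(4) d(4) by (simp_all add: algebra_simps)
  show "x + y \<in> K" unfolding sum using c d by (intro K_I kF.closed)
  show "x - y \<in> K" unfolding diff using c d by (intro K_I kF.closed)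
  show "x * y \<in> K" unfolding c(4) d(4) coords_mult
    using c d by (intro K_I kF.closed pi_mem_kF)
qed

lemma tau_coords:
  assumes "c0 \<in> kF" "c1 \<in> kF" "c2 \<in> kF"
  shows "\<tau> (c0 + c1 * \<rho> + c2 * \<rho> ^ 2) = c0 + zeta3 * c1 * \<rho> + zeta3 ^ 2 * c2 * \<rho> ^ 2"
  using assms rho_mem_K
  by (simp add: tau_add tau_mult tau_k tau_rho kF_mem_K K.closed power2_eq_square)

lemma zeta3_mem_kF: "zeta3 \<in> kF"
  by (intro Ok_kF zeta3_mem_Ok)

lemma tau_mem_K: "x \<in> K \<Longrightarrow> \<tau> x \<in> K"
  by (elim K_E) (auto simp: tau_coords intro!: K_I kF.closed zeta3_mem_kF)

lemma tau_tau_coords: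
  assumes "c0 \<in> kF" "c1 \<in> kF" "c2 \<in> kF"
  shows "\<tau> (\<tau> (c0 + c1 * \<rho> + c2 * \<rho> ^ 2)) = c0 + zeta3 ^ 2 * c1 * \<rho> + zeta3 * c2 * \<rho> ^ 2"
proof -
  have "\<tau> (\<tau> (c0 + c1 * \<rho> + c2 * \<rho> ^ 2)) = \<tau> (c0 + (zeta3 * c1) * \<rho> + (zeta3 ^ 2 * c2) * \<rho> ^ 2)"
    by (simp only: tau_coords[OF assms])
  also have "\<dots> = c0 + zeta3 * (zeta3 * c1) * \<rho> + zeta3 ^ 2 * (zeta3 ^ 2 * c2) * \<rho> ^ 2"
    by (intro tau_coords kF.closed assms zeta3_mem_kF)
  also have "zeta3 ^ 2 * (zeta3 ^ 2 * c2) = zeta3 ^ 3 * (zeta3 * c2)"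
    by (simp add: power2_eq_square power3_eq_cube)
  also have "zeta3 * (zeta3 * c1) = zeta3 ^ 2 * c1" by (simp add: power2_eq_square)
  finally show ?thesis by (simp add: zeta3_cube)
qed

lemma tau_tau_tau: "x \<in> K \<Longrightarrow> \<tau> (\<tau> (\<tau> x)) = x"
proof (elim K_E)
  fix c0 c1 c2 assume c: "c0 \<in> kF" "c1 \<in> kF" "c2 \<in> kF" and x: "x = c0 + c1 * \<rho> + c2 * \<rho> ^ 2"
  have "\<tau> (\<tau> (\<tau> x)) = \<tau> (c0 + (zeta3 ^ 2 * c1) * \<rho> + (zeta3 * c2) * \<rho> ^ 2)"
    unfolding x by (simp only: tau_tau_coords[OF c])
  also have "\<dots> = c0 + zeta3 * (zeta3 ^ 2 * c1) * \<rho> + zeta3 ^ 2 * (zeta3 * c2) * \<rho> ^ 2"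
    by (intro tau_coords kF.closed c zeta3_mem_kF)
  also have "\<dots> = c0 + zeta3 ^ 3 * c1 * \<rho> + zeta3 ^ 3 * c2 * \<rho> ^ 2"
    by (simp add: power2_eq_square power3_eq_cube)
  finally show "\<tau> (\<tau> (\<tau> x)) = x" by (simp add: zeta3_cube x)
qed

lemma tau_0: "\<tau> 0 = 0" and tau_1: "\<tau> 1 = 1"
  by (intro tau_k kF.closed)+

lemma tau_diff: "x \<in> K \<Longrightarrow> y \<in> K \<Longrightarrow> \<tau> (x - y) = \<tau> x - \<tau> y"
  using tau_add[of "x - y" y] by (simp add: K.closed eq_diff_eq)

lemma tau_power: "x \<in> K \<Longrightarrow> \<tau> (x ^ n) = \<tau> x ^ n"
  by (induction n) (simp_all add: tau_1 tau_mult K.closed)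

lemma tau_eq_0: "x \<in> K \<Longrightarrow> \<tau> x = 0 \<longleftrightarrow> x = 0"
  using tau_tau_tau[of x] tau_0 by metis

definition tr :: "complex \<Rightarrow> complex" where
  "tr x = x + \<tau> x + \<tau> (\<tau> x)"

lemma tr_coords:
  assumes "c0 \<in> kF" "c1 \<in> kF" "c2 \<in> kF"
  shows "tr (c0 + c1 * \<rho> + c2 * \<rho> ^ 2) = 3 * c0"
proof -
  have "tr (c0 + c1 * \<rho> + c2 * \<rho> ^ 2)
      = 3 * c0 + (1 + zeta3 + zeta3 ^ 2) * (c1 * \<rho>) + (1 + zeta3 + zeta3 ^ 2) * (c2 * \<rho> ^ 2)"
    unfolding tr_def tau_tau_coords[OF assms] unfolding tau_coords[OF assms]
    by (simp add: algebra_simps)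
  then show ?thesis by (simp add: zeta3_square)
qed

lemma tr_mem_kF: "x \<in> K \<Longrightarrow> tr x \<in> kF"
  by (elim K_E) (auto simp: tr_coords intro!: kF.closed)

lemma fixed_mem_kF:
  assumes "x \<in> K" "\<tau> x = x"
  shows "x \<in> kF"
proof -
  have "x = tr x / 3" using assms(2) by (simp add: tr_def)
  then show ?thesis using tr_mem_kF[OF assms(1)] divide_mem_kF kF.numeral_mem by metis
qed

abbreviation "N \<equiv> normK1 \<tau>"

lemma norm_mem_K: "x \<in> K \<Longrightarrow> N x \<in> K"
  unfolding normK1_def by (intro K.closed tau_mem_K)

lemma norm_mem_kF: "x \<in> K \<Longrightarrow> N x \<in> kF"
  by (rule fixed_mem_kF[OF norm_mem_K])
    (simp_all add: normK1_def tau_mult tau_mem_K K.closed tau_tau_tau)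

lemma norm_mult: "x \<in> K \<Longrightarrow> y \<in> K \<Longrightarrow> N (x * y) = N x * N y"
  by (simp add: normK1_def tau_mult tau_mem_K)

lemma norm_eq_0: "x \<in> K \<Longrightarrow> N x = 0 \<longleftrightarrow> x = 0"
  by (simp add: normK1_def tau_eq_0 tau_mem_K)

lemma norm_kF: "c \<in> kF \<Longrightarrow> N c = c ^ 3"
  by (simp add: normK1_def tau_k power3_eq_cube)

lemma norm_tau: "x \<in> K \<Longrightarrow> N (\<tau> x) = N x"
  by (simp add: normK1_def tau_tau_tau)

lemma inverse_mem_K:
  assumes "x \<in> K"
  shows "inverse x \<in> K"
proof (cases "x = 0")
  case False
  have "inverse x = \<tau> x * \<tau> (\<tau> x) * inverse (N x)"
    using False norm_eq_0[OF assms] by (simp add: normK1_def field_simps)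
  moreover have "\<tau> x * \<tau> (\<tau> x) * inverse (N x) \<in> K"
    by (rule K.mult_mem[OF K.mult_mem[OF tau_mem_K tau_mem_K[OF tau_mem_K]]
          kF_mem_K[OF inverse_mem_kF[OF norm_mem_kF]]]) (rule assms)+
  ultimately show ?thesis by (simp only:)
qed (simp add: K.closed)

lemma divide_mem_K: "x \<in> K \<Longrightarrow> y \<in> K \<Longrightarrow> x / y \<in> K"
  by (simp add: divide_inverse K.mult_mem inverse_mem_K)

lemma tau_divide:
  assumes "x \<in> K" "y \<in> K" "y \<noteq> 0"
  shows "\<tau> (x / y) = \<tau> x / \<tau> y"
proof -
  have "\<tau> (x / y) * \<tau> y = \<tau> x"
    using assms by (simp flip: tau_mult add: divide_mem_K)
  then show ?thesis using assms tau_eq_0 by (simp add: field_simps)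
qed

lemma norm_divide: "x \<in> K \<Longrightarrow> y \<in> K \<Longrightarrow> y \<noteq> 0 \<Longrightarrow> N (x / y) = N x / N y"
  by (simp add: normK1_def tau_divide tau_mem_K tau_eq_0)

sublocale \<O>: complex_subring \<O>
proof
  show "0 \<in> \<O>" "1 \<in> \<O>"
    using alg_int_of_int[of 0] alg_int_of_int[of 1] K.closed by (simp_all add: OK1_def)
qed (auto simp: OK1_def intro: K.closed alg_int_add_mult alg_int_diff)

lemma O_mem_K: "x \<in> \<O> \<Longrightarrow> x \<in> K" and O_alg_int: "x \<in> \<O> \<Longrightarrow> alg_int x"
  by (simp_all add: OK1_def)

lemma Ok_mem_O: "x \<in> Ok \<Longrightarrow> x \<in> \<O>"
  by (simp add: OK1_def kF_mem_K Ok_kF alg_int_Ok)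

lemma O_kF_mem_Ok: "x \<in> \<O> \<Longrightarrow> x \<in> kF \<Longrightarrow> x \<in> Ok"
  by (simp add: O_alg_int alg_int_kF)

lemma cube_root_mem_O: "w \<in> K \<Longrightarrow> w ^ 3 \<in> \<O> \<Longrightarrow> w \<in> \<O>"
  by (simp add: OK1_def alg_int_cube_root)

lemma rho_mem_O: "\<rho> \<in> \<O>"
  by (rule cube_root_mem_O) (simp_all add: rho_mem_K rho_cube Ok_mem_O pi_mem_Ok)

lemma tau_int_poly:
  assumes "x \<in> K"
  shows "poly (map_poly of_int p) x \<in> K"
    and "\<tau> (poly (map_poly of_int p) x) = poly (map_poly of_int p) (\<tau> x)"
proof (induction p)
  case 0
  { case 1 show ?case by (simp add: K.closed) next
    case 2 show ?case by (simp add: tau_0) }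
next
  case (pCons a p)
  { case 1 show ?case using pCons assms by (simp add: map_poly_pCons K.closed)
  next
    case 2 show ?case using pCons assms
      by (simp add: map_poly_pCons K.closed tau_add tau_mult tau_k kF.closed) }
qed

lemma tau_mem_O:
  assumes "x \<in> \<O>"
  shows "\<tau> x \<in> \<O>"
proof -
  obtain p :: "int poly" where "lead_coeff p = 1" "poly (map_poly of_int p) x = 0"
    using O_alg_int[OF assms] unfolding alg_int_def by blast
  moreover from this have "poly (map_poly of_int p) (\<tau> x) = 0"
    using tau_int_poly(2)[OF O_mem_K[OF assms], of p] tau_0 by simp
  ultimately show ?thesis
    using tau_mem_K[OF O_mem_K[OF assms]] unfolding OK1_def alg_int_def by blast
qed

lemma tr_mem_Ok: "x \<in> \<O> \<Longrightarrow> tr x \<in> Ok"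
  by (intro O_kF_mem_Ok tr_mem_kF O_mem_K) (simp_all add: tr_def \<O>.closed tau_mem_O)

lemma norm_mem_Ok: "x \<in> \<O> \<Longrightarrow> N x \<in> Ok"
  by (intro O_kF_mem_Ok norm_mem_kF O_mem_K) (simp_all add: normK1_def \<O>.closed tau_mem_O)

lemma dvd_in_O_Ok: "a \<in> Ok \<Longrightarrow> b \<in> Ok \<Longrightarrow> dvd_in \<O> a b \<Longrightarrow> dvd_in Ok a b"
  unfolding dvd_in_def[of \<O>] by (auto intro: dvd_in_Ok_if_alg_int O_alg_int)

lemma dvd_in_Ok_O: "dvd_in Ok a b \<Longrightarrow> dvd_in \<O> a b"
  unfolding dvd_in_def using Ok_mem_O by blast

lemma dvd_in_tau: "a \<in> Ok \<Longrightarrow> dvd_in \<O> a x \<Longrightarrow> dvd_in \<O> a (\<tau> x)"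
  unfolding dvd_in_def
  by (auto simp: tau_mult tau_k O_mem_K Ok_kF Ok_mem_O intro: tau_mem_O)

lemma clear_denominator:
  assumes "z \<in> K"
  obtains d where "d \<in> Ok" "d \<noteq> 0" "d * z \<in> \<O>"
proof -
  obtain c0 c1 c2 where c: "c0 \<in> kF" "c1 \<in> kF" "c2 \<in> kF" "z = c0 + c1 * \<rho> + c2 * \<rho> ^ 2"
    using K_E[OF assms] .
  obtain n0 n1 n2 :: int where n: "n0 \<noteq> 0" "of_int n0 * c0 \<in> Ok" "n1 \<noteq> 0" "of_int n1 * c1 \<in> Ok"
    "n2 \<noteq> 0" "of_int n2 * c2 \<in> Ok"
    using kF_fraction[OF c(1)] kF_fraction[OF c(2)] kF_fraction[OF c(3)] by metis
  have distrib: "x * y * w * (c0 + c1 * \<rho> + c2 * \<rho> ^ 2)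
      = y * w * (x * c0) + x * w * (y * c1) * \<rho> + x * y * (w * c2) * \<rho> ^ 2" for x y w
    by (simp only: ring_distribs ac_simps)
  have "of_int (n0 * n1 * n2) * z = of_int (n1 * n2) * (of_int n0 * c0)
      + of_int (n0 * n2) * (of_int n1 * c1) * \<rho> + of_int (n0 * n1) * (of_int n2 * c2) * \<rho> ^ 2"
    using distrib[of "of_int n0" "of_int n1" "of_int n2"] by (simp only: c(4) of_int_mult)
  also have "\<dots> \<in> \<O>" using n by (intro \<O>.closed rho_mem_O Ok_mem_O)
  finally show ?thesis using n by (intro that[of "of_int (n0 * n1 * n2)"]) (auto intro: Ok.closed)
qed

subsection \<open>Integrality of coordinates\<close>

text \<open>A factor \<pi> in the denominator of \<open>c\<close> would occur there at least three
  times after cubing, and \<open>i < 3\<close> factors cannot cancel it. In terms of elements: c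
  \<pi> is integral and \<pi> divides its cube.\<close>

lemma mem_Ok_if_cube_mult:
  assumes c: "c \<in> kF" and i: "i = 1 \<or> i = 2" and int: "c ^ 3 * \<pi> ^ i \<in> Ok"
  shows "c \<in> Ok"
proof -
  have eq: "(c * \<pi>) ^ 3 = \<pi> * (\<pi> ^ (2 - i) * (c ^ 3 * \<pi> ^ i))"
    using i by (auto simp: power2_eq_square power3_eq_cube)
  have mem: "(c * \<pi>) ^ 3 \<in> Ok" unfolding eq
    by (rule Ok.mult_mem[OF pi_mem_Ok Ok.mult_mem[OF Ok.power_mem[OF pi_mem_Ok] int]])
  have e: "c * \<pi> \<in> Ok"
  proof (rule alg_int_kF)
    show "c * \<pi> \<in> kF" using c pi_mem_kF by (rule kF.mult_mem)
    show "alg_int (c * \<pi>)" by (rule alg_int_cube_root) (rule alg_int_Ok[OF mem])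
  qed
  have "dvd_in Ok \<pi> ((c * \<pi>) ^ 3)"
    unfolding eq by (rule Ok.dvd_in_self[OF Ok.mult_mem[OF Ok.power_mem[OF pi_mem_Ok] int]])
  hence "dvd_in Ok \<pi> (c * \<pi>)" by (rule eis_prime_dvd_power[OF prime_pi e])
  then show ?thesis using pi_nonzero by (auto simp: dvd_in_def)
qed

text \<open>The three Lagrange resolvents of \<open>s\<close> are 3 c0, 3 c1 \<rho> and 3 c2
  \<rho>^2. They are integral, and the cubes of the last two lie in the base field, where the powers
  of \<pi> can be removed.\<close>

lemma coords_integral:
  assumes s: "s \<in> \<O>" and c: "c0 \<in> kF" "c1 \<in> kF" "c2 \<in> kF" "s = c0 + c1 * \<rho> + c2 * \<rho> ^ 2"
  shows "3 * c0 \<in> Ok" "3 * c1 \<in> Ok" "3 * c2 \<in> Ok"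
proof -
  have mem: "s + zeta3 ^ i * \<tau> s + zeta3 ^ j * \<tau> (\<tau> s) \<in> \<O>" for i j
    by (intro \<O>.closed tau_mem_O s Ok_mem_O zeta3_mem_Ok)
  have zz: "zeta3 * (zeta3 * x) = - x - zeta3 * x" for x
    using zeta3_square by (simp add: power2_eq_square flip: mult.assoc) (simp add: algebra_simps)
  show "3 * c0 \<in> Ok" using tr_mem_Ok[OF s] c by (simp add: tr_coords)
  have "s + zeta3 ^ 2 * \<tau> s + zeta3 ^ 1 * \<tau> (\<tau> s) = 3 * c1 * \<rho>"
    unfolding c(4) tau_tau_coords[OF c(1-3)] unfolding tau_coords[OF c(1-3)]
    by (simp add: algebra_simps power2_eq_square zz zz[of 1, simplified])
  hence m1: "3 * c1 * \<rho> \<in> \<O>" using mem[of 2 1] by (simp only:)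
  have e1: "(3 * c1 * \<rho>) ^ 3 = (3 * c1) ^ 3 * \<pi> ^ 1" by (simp add: power_mult_distrib rho_cube)
  have "(3 * c1) ^ 3 * \<pi> ^ 1 \<in> Ok"
  proof (rule O_kF_mem_Ok)
    show "(3 * c1) ^ 3 * \<pi> ^ 1 \<in> \<O>" unfolding e1[symmetric] by (rule \<O>.power_mem[OF m1])
    show "(3 * c1) ^ 3 * \<pi> ^ 1 \<in> kF" using c by (intro kF.closed pi_mem_kF)
  qed
  then show "3 * c1 \<in> Ok" using mem_Ok_if_cube_mult[OF kF.mult_mem[OF kF.numeral_mem c(2)], of 1] by blast
  have "s + zeta3 ^ 1 * \<tau> s + zeta3 ^ 2 * \<tau> (\<tau> s) = 3 * c2 * \<rho> ^ 2"
    unfolding c(4) tau_tau_coords[OF c(1-3)] unfolding tau_coords[OF c(1-3)]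
    by (simp add: algebra_simps power2_eq_square zz zz[of 1, simplified])
  hence m2: "3 * c2 * \<rho> ^ 2 \<in> \<O>" using mem[of 1 2] by (simp only:)
  have "(\<rho> ^ 2) ^ 3 = \<pi> ^ 2" by (metis power_mult mult.commute rho_cube)
  hence e2: "(3 * c2 * \<rho> ^ 2) ^ 3 = (3 * c2) ^ 3 * \<pi> ^ 2" by (simp add: power_mult_distrib)
  have "(3 * c2) ^ 3 * \<pi> ^ 2 \<in> Ok"
  proof (rule O_kF_mem_Ok)
    show "(3 * c2) ^ 3 * \<pi> ^ 2 \<in> \<O>" unfolding e2[symmetric] by (rule \<O>.power_mem[OF m2])
    show "(3 * c2) ^ 3 * \<pi> ^ 2 \<in> kF" using c by (intro kF.closed pi_mem_kF)
  qed
  then show "3 * c2 \<in> Ok" using mem_Ok_if_cube_mult[OF kF.mult_mem[OF kF.numeral_mem c(3)], of 2] by blast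
qed

definition \<omega> :: complex where "\<omega> = (\<rho> - 1) / sqrtm3"

lemma sqrtm3_omega: "sqrtm3 * \<omega> = \<rho> - 1"
  by (simp add: \<omega>_def)

text \<open>Substituting \<rho> = 1 + sqrt(-3) \<omega> into the equation of \<rho> and dividing by
  sqrt(-3)^3 gives \<omega>^3 - sqrt(-3) \<omega>^2 - \<omega> + e = 0, where e = (\<pi> - 1)/(3
  sqrt(-3)) is integral by the congruence. Modulo sqrt(-3) this is an Artin-Schreier equation, hence
  separable.\<close>

lemma omega_mem_O: "\<omega> \<in> \<O>"
proof -
  obtain e where e: "e \<in> Ok" "\<pi> - 1 = 3 * sqrtm3 * e"
    using pi_cong_1 by (auto simp: cong_in_def dvd_in_def)
  have l3: "sqrtm3 ^ 3 = - 3 * sqrtm3"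
    using sqrtm3_square by (simp add: power3_eq_cube power2_eq_square)
  have eq: "\<omega> ^ 3 - sqrtm3 * \<omega> ^ 2 - \<omega> + e = 0"
  proof -
    have "sqrtm3 ^ 3 * (\<omega> ^ 3 - sqrtm3 * \<omega> ^ 2 - \<omega> + e)
      = (sqrtm3 * \<omega>) ^ 3 - sqrtm3 ^ 2 * (sqrtm3 * \<omega>) ^ 2 - sqrtm3 ^ 2 * (sqrtm3 * \<omega>) + sqrtm3 ^ 3 * e"
      by (simp add: algebra_simps power2_eq_square power3_eq_cube)
    also have "\<dots> = (\<rho> - 1) ^ 3 + 3 * (\<rho> - 1) ^ 2 + 3 * (\<rho> - 1) - (\<pi> - 1)"
      unfolding sqrtm3_square sqrtm3_omega l3 e(2) by simp
    also have "\<dots> = 0"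
      unfolding rho_cube[symmetric] by (simp add: power2_eq_square power3_eq_cube algebra_simps)
    finally show ?thesis by simp
  qed
  obtain a b where ab: "e = of_int a + of_int b * zeta3" using e(1) by (auto simp: Ok_def)
  define A B where "A = 2 * a - b" and "B = a ^ 2 - a * b + b ^ 2"
  define e' where "e' = of_int a + of_int b * zeta3 ^ 2"
  have ee: "e + e' = of_int A" "e * e' = of_int B"
    using norm_zeta3_form[of "of_int a" "of_int b"]
    by (simp_all add: ab e'_def A_def B_def zeta3_square of_rat_add of_rat_diff of_rat_mult of_rat_power
        right_diff_distrib)
  have le: "sqrtm3 * (e - e') = - 3 * of_int b"
  proof -
    have "e - e' = of_int b * sqrtm3"
      by (simp add: ab e'_def zeta3_square sqrtm3_def algebra_simps)
    hence "sqrtm3 * (e - e') = of_int b * sqrtm3 ^ 2" by (simp add: power2_eq_square)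
    then show ?thesis by (simp add: sqrtm3_square)
  qed
  \<comment> \<open>The product of the cubic for \<omega> with its complex conjugate, because
    \<open>alg_int\<close> asks for a polynomial over the integers.\<close>
  define p :: "int poly" where "p = [:B, -A, 1 - 3 * b, A, 1, 0, 1:]"
  have "poly (map_poly of_int p) \<omega> =
      of_int B + \<omega> * (- of_int A + \<omega> * (1 - 3 * of_int b + \<omega> * (of_int A + \<omega> * (1 + \<omega> * \<omega>))))"
    by (simp add: p_def map_poly_pCons)
  also have "\<dots> = (\<omega> ^ 3 - \<omega>) ^ 2 + of_int A * (\<omega> ^ 3 - \<omega>) + 3 * \<omega> ^ 4 - 3 * of_int b * \<omega> ^ 2 + of_int B"
    by (simp add: algebra_simps eval_nat_numeral)
  also have "\<dots> = (\<omega> ^ 3 - sqrtm3 * \<omega> ^ 2 - \<omega> + e) * (\<omega> ^ 3 + sqrtm3 * \<omega> ^ 2 - \<omega> + e')"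
  proof -
    have "(\<omega> ^ 3 - sqrtm3 * \<omega> ^ 2 - \<omega> + e) * (\<omega> ^ 3 + sqrtm3 * \<omega> ^ 2 - \<omega> + e')
      = (\<omega> ^ 3 - \<omega>) ^ 2 + (e + e') * (\<omega> ^ 3 - \<omega>) - sqrtm3 ^ 2 * \<omega> ^ 4
        + sqrtm3 * (e - e') * \<omega> ^ 2 + e * e'"
      by (simp add: algebra_simps eval_nat_numeral)
    then show ?thesis unfolding ee le sqrtm3_square by (simp add: algebra_simps)
  qed
  finally have "poly (map_poly of_int p) \<omega> = 0" using eq by simp
  moreover have "lead_coeff p = 1" by (simp add: p_def)
  ultimately have "alg_int \<omega>" unfolding alg_int_def by blast
  moreover have "\<omega> \<in> K"
    unfolding \<omega>_def by (intro divide_mem_K K.closed rho_mem_K kF_mem_K Ok_kF sqrtm3_mem_Ok)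
  ultimately show ?thesis by (simp add: OK1_def)
qed

subsection \<open>Unramified primes: reducedness modulo q\<close>

text \<open>Modulo \<open>q\<close> the conjugates of \<open>s * t\<close> are nilpotent, so their
  sum is nilpotent too; it lies in \<open>Ok\<close>, where \<open>q\<close> is prime.\<close>

lemma tr_dvd_if_cube_dvd:
  assumes q: "prime_elem_in Ok q" and s: "s \<in> \<O>" "dvd_in \<O> q (s ^ 3)" and t: "t \<in> \<O>"
  shows "dvd_in Ok q (tr (s * t))"
proof -
  have qOk: "q \<in> Ok" using q by (simp add: prime_elem_in_def)
  define a b c where "a = s * t" and "b = \<tau> a" and "c = \<tau> b"
  have mem: "a \<in> \<O>" "b \<in> \<O>" "c \<in> \<O>"
    unfolding c_def b_def a_def by (intro tau_mem_O \<O>.closed s t)+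
  have a: "dvd_in \<O> q (a ^ 3)"
    unfolding a_def power_mult_distrib using s t by (intro \<O>.dvd_in_mult_right \<O>.closed)
  have b: "dvd_in \<O> q (b ^ 3)"
    unfolding b_def using dvd_in_tau[OF qOk a] by (simp add: tau_power O_mem_K mem)
  have c: "dvd_in \<O> q (c ^ 3)"
    unfolding c_def using dvd_in_tau[OF qOk b] by (simp add: tau_power O_mem_K mem)
  \<comment> \<open>a monomial of degree 7 in a, b, c contains the cube of one of them\<close>
  have "(a + b) ^ 5 = a ^ 3 * (a ^ 2 + 5 * a * b + 10 * b ^ 2) + b ^ 3 * (10 * a ^ 2 + 5 * a * b + b ^ 2)"
    by (simp add: algebra_simps eval_nat_numeral)
  also have "dvd_in \<O> q \<dots>"
    by (intro \<O>.dvd_in_add \<O>.dvd_in_mult_right a b \<O>.closed mem)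
  finally have ab: "dvd_in \<O> q ((a + b) ^ 5)" .
  define e where "e = a + b"
  have e: "e \<in> \<O>" unfolding e_def by (intro \<O>.closed mem)
  have "(e + c) ^ 7 = e ^ 5 * (e ^ 2 + 7 * e * c + 21 * c ^ 2)
      + c ^ 3 * (35 * e ^ 4 + 35 * e ^ 3 * c + 21 * e ^ 2 * c ^ 2 + 7 * e * c ^ 3 + c ^ 4)"
    by (simp add: algebra_simps eval_nat_numeral)
  also have "dvd_in \<O> q \<dots>"
    using ab unfolding e_def[symmetric]
    by (intro \<O>.dvd_in_add \<O>.dvd_in_mult_right c \<O>.closed mem e)
  finally have "dvd_in \<O> q (tr (s * t) ^ 7)" by (simp add: e_def tr_def a_def b_def c_def)
  moreover have "tr (s * t) \<in> Ok" using s t by (intro tr_mem_Ok \<O>.closed)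
  ultimately have "dvd_in Ok q (tr (s * t) ^ 7)" using qOk by (intro dvd_in_O_Ok Ok.closed)
  then show ?thesis by (rule eis_prime_dvd_power[OF q \<open>tr (s * t) \<in> Ok\<close>])
qed

text \<open>Nondegeneracy of the trace form on 1, \<rho>, \<rho>^2: pairing \<open>s\<close> with 1,
  \<rho>^2 and \<rho> isolates the three coordinates, up to the factors 3 and \<pi>, which are
  invertible modulo \<open>q\<close>.\<close>

lemma reduced_away_from_3:
  assumes q: "prime_elem_in Ok q" "\<not> dvd_in Ok q \<pi>" "\<not> dvd_in Ok q 3"
    and s: "s \<in> \<O>" "dvd_in \<O> q (s ^ 3)"
  shows "dvd_in \<O> q s"
proof -
  obtain c0 c1 c2 where c: "c0 \<in> kF" "c1 \<in> kF" "c2 \<in> kF" "s = c0 + c1 * \<rho> + c2 * \<rho> ^ 2"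
    using K_E[OF O_mem_K[OF s(1)]] .
  note int = coords_integral[OF s(1) c]
  have "tr (s * 1) = 3 * c0" using c by (simp add: tr_coords)
  hence d0: "dvd_in Ok q (3 * c0)" using tr_dvd_if_cube_dvd[OF q(1) s \<O>.one_mem] by simp
  have "tr (s * \<rho> ^ 2) = 3 * c1 * \<pi>"
    using coords_mult[of c0 c1 c2 0 0 1] tr_coords[of "\<pi> * c1" "\<pi> * c2" c0] c pi_mem_Ok
    by (simp add: kF.closed Ok_kF)
  hence "dvd_in Ok q (3 * c1 * \<pi>)"
    using tr_dvd_if_cube_dvd[OF q(1) s \<O>.power_mem[OF rho_mem_O], of 2] by simp
  hence d1: "dvd_in Ok q (3 * c1)" using eis_prime_dvd_mult[OF q(1) int(2) pi_mem_Ok] q(2) by blast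
  have "tr (s * \<rho>) = 3 * c2 * \<pi>"
    using coords_mult[of c0 c1 c2 0 1 0] tr_coords[of "\<pi> * c2" c0 c1] c pi_mem_Ok
    by (simp add: kF.closed Ok_kF)
  hence "dvd_in Ok q (3 * c2 * \<pi>)"
    using tr_dvd_if_cube_dvd[OF q(1) s rho_mem_O] by simp
  hence d2: "dvd_in Ok q (3 * c2)" using eis_prime_dvd_mult[OF q(1) int(3) pi_mem_Ok] q(2) by blast
  have "3 * s = 3 * c0 + 3 * c1 * \<rho> + 3 * c2 * \<rho> ^ 2" by (simp add: c(4))
  also have "dvd_in \<O> q \<dots>"
    using d0 d1 d2
    by (intro \<O>.dvd_in_add \<O>.dvd_in_mult_right dvd_in_Ok_O[OF d0] dvd_in_Ok_O[OF d1] dvd_in_Ok_O[OF d2]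
        rho_mem_O \<O>.power_mem)
  finally have d: "dvd_in \<O> q (3 * s)" .
  obtain u v where uv: "u \<in> Ok" "v \<in> Ok" "3 * u + q * v = 1"
    using prime_bezout[OF q(1) _ q(3)] Ok.numeral_mem by metis
  have "s = (3 * u + q * v) * s" by (simp add: uv(3))
  also have "\<dots> = 3 * s * u + q * (v * s)" by (simp add: algebra_simps)
  also have "dvd_in \<O> q \<dots>"
    by (intro \<O>.dvd_in_add \<O>.dvd_in_mult_right[OF d] \<O>.dvd_in_self \<O>.closed
        Ok_mem_O[OF uv(1)] Ok_mem_O[OF uv(2)] s(1))
  finally show ?thesis .
qed

text \<open>The order generated by \<open>\<omega>\<close> has discriminant \<open>\<pi>\<^sup>2\<close> up to a unit, so the trace form with
  respect to \<open>1, \<omega>, \<omega>\<^sup>2\<close> is nondegenerate modulo \<open>\<surd>-3\<close>.\<close>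

lemma reduced_sqrtm3:
  assumes s: "s \<in> \<O>" "dvd_in \<O> sqrtm3 (s ^ 3)"
  shows "dvd_in \<O> sqrtm3 s"
proof -
  obtain c0 c1 c2 where c: "c0 \<in> kF" "c1 \<in> kF" "c2 \<in> kF" "s = c0 + c1 * \<rho> + c2 * \<rho> ^ 2"
    using K_E[OF O_mem_K[OF s(1)]] .
  note int = coords_integral[OF s(1) c]
  obtain f where f: "f \<in> Ok" "\<pi> - 1 = 3 * sqrtm3 * f"
    using pi_cong_1 by (auto simp: cong_in_def dvd_in_def)
  hence pi: "\<pi> = 1 + 3 * sqrtm3 * f" by (simp add: algebra_simps)
  have kl: "sqrtm3 \<in> kF" by (intro Ok_kF sqrtm3_mem_Ok)
  have lsq: "sqrtm3 * (sqrtm3 * x) = - 3 * x" for x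
    using sqrtm3_square by (simp add: power2_eq_square flip: mult.assoc)
  have "tr (s * 1) = 3 * c0" using c by (simp add: tr_coords)
  then obtain h where h: "h \<in> Ok" "3 * c0 = sqrtm3 * h"
    using tr_dvd_if_cube_dvd[OF prime_sqrtm3 s \<O>.one_mem] by (auto simp: dvd_in_def)
  have "s * \<omega> = (\<pi> * c2 - c0) / sqrtm3 + (c0 - c1) / sqrtm3 * \<rho> + (c1 - c2) / sqrtm3 * \<rho> ^ 2"
    using coords_mult[of c0 c1 c2 "-1" 1 0] unfolding c(4) \<omega>_def
    by (simp add: field_simps)
  hence "tr (s * \<omega>) = 3 * ((\<pi> * c2 - c0) / sqrtm3)"
    using c kl pi_mem_kF by (simp only:) (intro tr_coords divide_mem_kF kF.closed)
  also have "\<dots> = sqrtm3 * (c0 - \<pi> * c2)"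
    using sqrtm3_square by (simp add: field_simps power2_eq_square) (simp add: lsq flip: mult.assoc)
  finally have g1: "c0 - \<pi> * c2 \<in> Ok"
    using tr_dvd_if_cube_dvd[OF prime_sqrtm3 s omega_mem_O] by (auto simp: dvd_in_def)
  have "s * \<omega> ^ 2 = (s * (1 + (-2) * \<rho> + 1 * \<rho> ^ 2)) / (-3)"
    unfolding \<omega>_def power_divide sqrtm3_square by (simp add: power2_eq_square algebra_simps)
  also have "\<dots> = ((c0 + \<pi> * c1 - 2 * \<pi> * c2) + (\<pi> * c2 - 2 * c0 + c1) * \<rho>
      + (c0 - 2 * c1 + c2) * \<rho> ^ 2) / (-3)"
    unfolding c(4) coords_mult by (simp add: algebra_simps)
  also have "\<dots> = (c0 + \<pi> * c1 - 2 * \<pi> * c2) / (-3) + (\<pi> * c2 - 2 * c0 + c1) / (-3) * \<rho>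
      + (c0 - 2 * c1 + c2) / (-3) * \<rho> ^ 2"
    by (simp add: field_simps)
  finally have "tr (s * \<omega> ^ 2) = 3 * ((c0 + \<pi> * c1 - 2 * \<pi> * c2) / (-3))"
    using c pi_mem_kF by (simp only:) (intro tr_coords divide_mem_kF kF.closed)
  moreover have "3 * (u / (-3)) = - u" for u :: complex by simp
  ultimately have "tr (s * \<omega> ^ 2) = - (c0 + \<pi> * c1 - 2 * \<pi> * c2)" by (simp only:)
  then obtain g where g: "g \<in> Ok" "- (c0 + \<pi> * c1 - 2 * \<pi> * c2) = sqrtm3 * g"
    using tr_dvd_if_cube_dvd[OF prime_sqrtm3 s \<O>.power_mem[OF omega_mem_O], of 2] by (auto simp: dvd_in_def)
  \<comment> \<open>The trace relations contain \<pi>. Replacing \<pi> by 1 changes them by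
    multiples of 3 sqrt(-3) f, and the factor 3 makes the coordinates integral; \<open>g'\<close>
    collects these corrections.\<close>
  define g' where "g' = - g - f * (3 * c1 - 2 * (3 * c2))"
  have g'Ok: "g' \<in> Ok" unfolding g'_def
    by (rule Ok.diff_mem[OF Ok.minus_mem[OF g(1)] Ok.mult_mem[OF f(1)
          Ok.diff_mem[OF int(2) Ok.mult_mem[OF Ok.numeral_mem int(3)]]]])
  have B: "c0 + c1 - 2 * c2 = sqrtm3 * g'"
  proof -
    have "c0 + c1 - 2 * c2 = (c0 + \<pi> * c1 - 2 * \<pi> * c2) - sqrtm3 * f * (3 * c1 - 2 * (3 * c2))"
      unfolding pi by (simp add: algebra_simps)
    also have "\<dots> = - (sqrtm3 * g) - sqrtm3 * f * (3 * c1 - 2 * (3 * c2))"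
      unfolding g(2)[symmetric] by simp
    finally show ?thesis by (simp add: g'_def algebra_simps)
  qed
  have "c2 - c0 = - (c0 - \<pi> * c2) - sqrtm3 * f * (3 * c2)" unfolding pi by (simp add: algebra_simps)
  also have "\<dots> \<in> Ok"
    by (rule Ok.diff_mem[OF Ok.minus_mem[OF g1] Ok.mult_mem[OF Ok.mult_mem[OF sqrtm3_mem_Ok f(1)] int(3)]])
  finally have A: "c2 - c0 \<in> Ok" .
  have "sqrtm3 * c0 = - h"
  proof -
    have "sqrtm3 * (sqrtm3 * c0) = sqrtm3 * (- h)" unfolding lsq using h(2) by simp
    then show ?thesis unfolding mult_cancel_left by simp
  qed
  hence "sqrtm3 * c2 = sqrtm3 * (c2 - c0) - h" by (simp add: algebra_simps)
  hence cc: "sqrtm3 * c2 \<in> Ok" 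
    using Ok.diff_mem[OF Ok.mult_mem[OF sqrtm3_mem_Ok A] h(1)] by (simp only:)
  have "c1 + 2 * c2 = sqrtm3 * g' + 3 * c2 + (c2 - c0)" using B[symmetric] by simp
  also have "\<dots> \<in> Ok"
    by (rule Ok.add_mem[OF Ok.add_mem[OF Ok.mult_mem[OF sqrtm3_mem_Ok g'Ok] int(3)] A])
  finally have bb: "c1 + 2 * c2 \<in> Ok" .
  \<comment> \<open>The expansion of \<open>s\<close> in powers of \<rho> - 1 = sqrt(-3) \<omega>,
    divided by sqrt(-3). The constant term c0 + c1 + c2 is split as (c0 + c1 - 2 c2) + 3 c2, since
    \<open>B\<close> controls the first part.\<close>
  define v where "v = (g' - sqrtm3 * c2) + (c1 + 2 * c2) * \<omega> + (sqrtm3 * c2) * \<omega> ^ 2"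
  have v: "v \<in> \<O>" unfolding v_def
    by (rule \<O>.add_mem[OF \<O>.add_mem[OF \<O>.diff_mem[OF Ok_mem_O[OF g'Ok] Ok_mem_O[OF cc]]
          \<O>.mult_mem[OF Ok_mem_O[OF bb] omega_mem_O]]
          \<O>.mult_mem[OF Ok_mem_O[OF cc] \<O>.power_mem[OF omega_mem_O]]])
  have "sqrtm3 * v = sqrtm3 * g' - sqrtm3 * (sqrtm3 * c2) + (c1 + 2 * c2) * (sqrtm3 * \<omega>) + c2 * (sqrtm3 * \<omega>) ^ 2"
    by (simp add: v_def algebra_simps power2_eq_square)
  also have "\<dots> = (c0 + c1 - 2 * c2) + 3 * c2 + (c1 + 2 * c2) * (\<rho> - 1) + c2 * (\<rho> - 1) ^ 2"
    unfolding lsq sqrtm3_omega B by simp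
  also have "\<dots> = s" by (simp add: c(4) algebra_simps power2_eq_square)
  finally show ?thesis using v by (auto simp: dvd_in_def)
qed

lemma reduced:
  assumes q: "prime_elem_in Ok q" "\<not> dvd_in Ok q \<pi>" and s: "s \<in> \<O>" "dvd_in \<O> q (s ^ 3)"
  shows "dvd_in \<O> q s"
proof (cases "dvd_in Ok q 3")
  case True
  note l = prime_dvd_3_associated[OF q(1) True]
  have "dvd_in \<O> sqrtm3 (s ^ 3)" using l(2) s(2) dvd_in_Ok_O \<O>.dvd_in_trans by blast
  hence "dvd_in \<O> sqrtm3 s" by (rule reduced_sqrtm3[OF s(1)])
  then show ?thesis using l(1) dvd_in_Ok_O \<O>.dvd_in_trans by blast
qed (use reduced_away_from_3 assms in blast)

subsection \<open>Cubes in the cubic extension\<close>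

text \<open>The resolvent \<open>Z e\<close> has the required property as soon as it is nonzero. Not
  all of \<open>Z 1\<close>, \<open>Z \<rho>\<close>, \<open>Z (\<rho> ^ 2)\<close> vanish, because
  dividing them by 1, \<rho>, \<rho>^2 and adding gives 3.\<close>

lemma hilbert90:
  assumes y: "y \<in> K" "N y = 1"
  obtains z where "z \<in> K" "z \<noteq> 0" "y * \<tau> z = z"
proof -
  define Z where "Z e = e + y * \<tau> e + y * \<tau> y * \<tau> (\<tau> e)" for e
  have Z: "Z e \<in> K" "y * \<tau> (Z e) = Z e" if e: "e \<in> K" for e
  proof -
    show "Z e \<in> K" unfolding Z_def by (intro K.closed tau_mem_K y e)
    have "\<tau> (Z e) = \<tau> e + \<tau> y * \<tau> (\<tau> e) + \<tau> y * \<tau> (\<tau> y) * e"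
      using e y by (simp add: Z_def tau_add tau_mult K.closed tau_mem_K tau_tau_tau)
    hence "y * \<tau> (Z e) = y * \<tau> e + y * \<tau> y * \<tau> (\<tau> e) + N y * e"
      by (simp add: normK1_def algebra_simps)
    then show "y * \<tau> (Z e) = Z e" by (simp add: y(2) Z_def)
  qed
  have r0: "\<rho> \<noteq> 0" using rho_cube pi_nonzero by auto
  have t1: "\<tau> \<rho> = zeta3 * \<rho>" "\<tau> (\<tau> \<rho>) = zeta3 ^ 2 * \<rho>"
    using tau_coords[of 0 1 0] tau_tau_coords[of 0 1 0] by (simp_all add: kF.closed)
  have t2: "\<tau> (\<rho> ^ 2) = zeta3 ^ 2 * \<rho> ^ 2" "\<tau> (\<tau> (\<rho> ^ 2)) = zeta3 * \<rho> ^ 2"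
    using tau_coords[of 0 0 1] tau_tau_coords[of 0 0 1] by (simp_all add: kF.closed)
  have "Z 1 \<noteq> 0 \<or> Z \<rho> \<noteq> 0 \<or> Z (\<rho> ^ 2) \<noteq> 0"
  proof (rule ccontr)
    assume "\<not> ?thesis"
    hence "Z 1 + Z \<rho> / \<rho> + Z (\<rho> ^ 2) / \<rho> ^ 2 = 0" by simp
    moreover have "Z 1 = 1 + y + y * \<tau> y" by (simp add: Z_def tau_1)
    moreover have "Z \<rho> / \<rho> = 1 + y * zeta3 + y * \<tau> y * zeta3 ^ 2"
      unfolding Z_def t1(2) unfolding t1(1) using r0 by (simp add: field_simps)
    moreover have "Z (\<rho> ^ 2) / \<rho> ^ 2 = 1 + y * zeta3 ^ 2 + y * \<tau> y * zeta3"
      unfolding Z_def t2(2) unfolding t2(1) using r0 by (simp add: field_simps)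
    ultimately have "3 + (1 + zeta3 + zeta3 ^ 2) * (y + y * \<tau> y) = 0"
      by (simp add: algebra_simps)
    then show False by (simp add: zeta3_square)
  qed
  then show ?thesis using that Z rho_mem_K K.one_mem K.power_mem by metis
qed

section \<open>The exact power of a base-field prime dividing an element or a set\<close>

lemma exact_power:
  assumes q: "prime_elem_in Ok q" and S: "S \<subseteq> \<O>" "s0 \<in> S" "s0 \<noteq> 0"
  obtains n s where "\<And>s. s \<in> S \<Longrightarrow> dvd_in \<O> (q ^ n) s" "s \<in> S" "\<not> dvd_in \<O> (q ^ Suc n) s"
proof -
  have qOk: "q \<in> Ok" using q by (simp add: prime_elem_in_def)
  have "\<exists>n. (\<forall>s\<in>S. dvd_in \<O> (q ^ n) s) \<and> \<not> (\<forall>s\<in>S. dvd_in \<O> (q ^ Suc n) s)"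
  proof (rule ccontr)
    assume "\<not> ?thesis"
    hence step: "(\<forall>s\<in>S. dvd_in \<O> (q ^ n) s) \<Longrightarrow> (\<forall>s\<in>S. dvd_in \<O> (q ^ Suc n) s)" for n by blast
    have all: "\<forall>s\<in>S. dvd_in \<O> (q ^ n) s" for n
    proof (induction n)
      case 0
      show ?case using S by (auto simp: dvd_in_def)
    qed (rule step)
    \<comment> \<open>The exponent \<open>M\<close> alone is contradictory: if q^M divided
      \<open>s0\<close>, comparing norms would give 2^M <= M.\<close>
    define M where "M = eis_norm (N s0)"
    obtain v where v: "v \<in> \<O>" "s0 = q ^ M * v" using all S unfolding dvd_in_def by blast
    have vOk: "N v \<in> Ok" by (rule norm_mem_Ok[OF v(1)])
    have qk: "q ^ M \<in> kF" "q ^ M \<in> Ok" using qOk by (auto intro: Ok_kF Ok.power_mem)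
    have Ns: "N s0 = (q ^ M) ^ 3 * N v"
      unfolding v(2) using qk v by (simp add: norm_mult norm_kF kF_mem_K O_mem_K)
    have "M = eis_norm ((q ^ M) ^ 3 * N v)" unfolding Ns[symmetric] by (rule M_def)
    also have "\<dots> = eis_norm (q ^ M) ^ 3 * eis_norm (N v)"
      using qk(2) vOk by (simp add: eis_norm_mult power3_eq_cube Ok.mult_mem)
    finally have "M = eis_norm (q ^ M) ^ 3 * eis_norm (N v)" .
    moreover have "eis_norm (N v) \<noteq> 0"
      using v S norm_eq_0 O_mem_K by (auto simp: eis_norm_eq_0[OF vOk])
    moreover have "eis_norm (q ^ m) = eis_norm q ^ m" for m
      by (induction m) (simp_all add: eis_norm_1 eis_norm_mult Ok.power_mem qOk)
    ultimately have "(eis_norm q ^ M) ^ 3 \<le> M" by (metis One_nat_def Suc_leI mult.right_neutral mult_le_mono2 neq0_conv)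
    moreover have "2 ^ M \<le> eis_norm q ^ M" by (intro power_mono prime_eis_norm q) simp
    moreover have "eis_norm q ^ M \<le> (eis_norm q ^ M) ^ 3"
      using prime_eis_norm[OF q] by (intro self_le_power) auto
    ultimately have "2 ^ M \<le> M" by linarith
    then show False by (metis less_exp not_le)
  qed
  then show ?thesis using that by blast
qed

lemma exact_power_single:
  assumes q: "prime_elem_in Ok q" and w: "w \<in> \<O>" "w \<noteq> 0"
  obtains n w' where "w' \<in> \<O>" "w = q ^ n * w'" "\<not> dvd_in \<O> q w'"
proof -
  obtain n s where n: "\<And>s. s \<in> {w} \<Longrightarrow> dvd_in \<O> (q ^ n) s" "s \<in> {w}" "\<not> dvd_in \<O> (q ^ Suc n) s"
    using exact_power[OF q, of "{w}" w] w by auto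
  then obtain w' where w': "w' \<in> \<O>" "w = q ^ n * w'" by (auto simp: dvd_in_def)
  have "\<not> dvd_in \<O> q w'"
  proof
    assume "dvd_in \<O> q w'"
    then obtain v where "v \<in> \<O>" "w' = q * v" by (auto simp: dvd_in_def)
    hence "dvd_in \<O> (q ^ Suc n) w" by (intro \<O>.dvd_inI[of v]) (simp_all add: w'(2))
    with n show False by simp
  qed
  with w' show ?thesis by (rule that)
qed

lemma exact_power_Ok:
  assumes q: "prime_elem_in Ok q" and m: "m \<in> Ok" "m \<noteq> 0"
  obtains n m' where "m' \<in> Ok" "m = q ^ n * m'" "\<not> dvd_in Ok q m'"
proof -
  obtain n m' where m': "m' \<in> \<O>" "m = q ^ n * m'" "\<not> dvd_in \<O> q m'"
    using exact_power_single[OF q Ok_mem_O[OF m(1)] m(2)] .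
  have q0: "q \<in> Ok" "q \<noteq> 0" using q by (auto simp: prime_elem_in_def)
  have "m' = m / q ^ n" using m'(2) q0 by simp
  hence "m' \<in> kF"
    using divide_mem_kF[OF Ok_kF[OF m(1)] kF.power_mem[OF Ok_kF[OF q0(1)]]] by simp
  hence "m' \<in> Ok" using O_kF_mem_Ok m' by blast
  then show ?thesis using that m' dvd_in_Ok_O by blast
qed

text \<open>\<open>q\<close> may decompose in \<O>, so the cancellation rests on an inverse of
  \<open>a\<close> modulo \<open>q\<close> rather than on primality in \<O>.\<close>

lemma prime_dvd_cancel:
  assumes q: "prime_elem_in Ok q" and a: "a \<in> Ok" "\<not> dvd_in Ok q a"
    and x: "x \<in> \<O>" "dvd_in \<O> q (a * x)"
  shows "dvd_in \<O> q x"
proof -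
  obtain u v where uv: "u \<in> Ok" "v \<in> Ok" "a * u + q * v = 1" using prime_bezout[OF q a] .
  have "x = (a * u + q * v) * x" by (simp add: uv(3))
  also have "\<dots> = u * (a * x) + q * (v * x)" by (simp add: algebra_simps)
  also have "dvd_in \<O> q \<dots>"
    by (intro \<O>.dvd_in_add \<O>.dvd_in_mult_left[OF x(2)] \<O>.dvd_in_self \<O>.mult_mem x(1)
        Ok_mem_O[OF uv(1)] Ok_mem_O[OF uv(2)])
  finally show ?thesis .
qed

lemma exact_power_unique:
  assumes "q \<noteq> 0" "q ^ a * X = q ^ b * Y" "X \<in> \<O>" "Y \<in> \<O>" "q \<in> \<O>"
    and "\<not> dvd_in \<O> q X" "\<not> dvd_in \<O> q Y"
  shows "a = b"
proof -
  have False if "a < b" "q ^ a * X = q ^ b * Y" "\<not> dvd_in \<O> q X" "Y \<in> \<O>" for a b X Y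
  proof -
    have "q ^ b = q ^ (a + Suc (b - Suc a))" using that(1) by simp
    hence "q ^ b = q ^ a * (q * q ^ (b - Suc a))" by (simp only: power_add power_Suc)
    hence "X = q * (q ^ (b - Suc a) * Y)" using that(2) assms(1) by simp
    hence "dvd_in \<O> q X"
      by (rule \<O>.dvd_inI[rotated]) (intro \<O>.mult_mem \<O>.power_mem assms that)
    then show False using that by blast
  qed
  from this[of a b X Y] this[of b a Y X] show ?thesis using assms by (metis linorder_neqE_nat)
qed

text \<open>\<open>S\<close> is any generating set of the ideal whose cube is meant. Leaving it
  unsaturated lets products and conjugates be formed directly on generators.\<close>

definition ideal_cube :: "complex \<Rightarrow> bool" where
  "ideal_cube x \<longleftrightarrow> (\<exists>S \<subseteq> \<O>. \<O>.gen_ideal (S ^ 3) = principal \<O> x)"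

text \<open>Modulo a prime \<open>q\<close> not dividing \<open>\<pi>\<close> the ring is reduced, hence the \<open>q\<close>-content is compatible with
  cubing both elements and ideals.\<close>

lemma content_of_ideal_cube:
  assumes q: "prime_elem_in Ok q" "\<not> dvd_in Ok q \<pi>"
    and x: "x \<in> \<O>" "x \<noteq> 0" "ideal_cube x"
    and m: "m \<in> Ok" "\<not> dvd_in Ok q m" and z: "z \<in> K" and eq: "x = q ^ i * m * z ^ 3"
  shows "3 dvd i"
proof -
  have q0: "q \<in> Ok" "q \<noteq> 0" using q by (auto simp: prime_elem_in_def)
  have qO: "q \<in> \<O>" by (rule Ok_mem_O[OF q0(1)])
  obtain S where S: "S \<subseteq> \<O>" "\<O>.gen_ideal (S ^ 3) = principal \<O> x" using x(3) by (auto simp: ideal_cube_def)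
  have xgen: "x \<in> \<O>.gen_ideal (S ^ 3)" unfolding S(2) \<O>.principal_eq by (simp add: \<O>.dvd_in_refl)
  have S3: "S ^ 3 = S * S * S" by (simp add: power3_eq_cube)
  have "\<exists>s\<in>S. s \<noteq> 0"
  proof (rule ccontr)
    assume "\<not> ?thesis"
    hence "S ^ 3 \<subseteq> {v. dvd_in \<O> 0 v}" unfolding S3 by (auto simp: set_times_def dvd_in_def intro: \<O>.closed)
    hence "x \<in> {v. dvd_in \<O> 0 v}"
      using xgen \<O>.gen_ideal_minimal[OF \<O>.ideal_principal[OF \<O>.zero_mem]] by blast
    then show False using x(2) by (auto simp: dvd_in_def)
  qed
  then obtain s0 where "s0 \<in> S" "s0 \<noteq> 0" by blast
  \<comment> \<open>q^n is the exact power of \<open>q\<close> dividing all of \<open>S\<close>,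
    attained at \<open>s\<close>. Hence q^(3n) divides \<open>x\<close>; that no further
    \<open>q\<close> does follows because the cube of s' = s / q^n is a multiple of x' = x / q^(3n),
    and reducedness keeps \<open>q\<close> from dividing that cube.\<close>
  then obtain n s where n: "\<And>s. s \<in> S \<Longrightarrow> dvd_in \<O> (q ^ n) s" and s: "s \<in> S" "\<not> dvd_in \<O> (q ^ Suc n) s"
    using exact_power[OF q(1) S(1)] by metis
  have "S ^ 3 \<subseteq> {v. dvd_in \<O> (q ^ n * q ^ n * q ^ n) v}"
    unfolding S3 by (auto simp: set_times_def intro!: \<O>.dvd_in_mult_mono n)
  moreover have "\<O>.gen_ideal (S ^ 3) \<subseteq> {v. dvd_in \<O> (q ^ n * q ^ n * q ^ n) v}" if "S ^ 3 \<subseteq> {v. dvd_in \<O> (q ^ n * q ^ n * q ^ n) v}"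
    by (rule \<O>.gen_ideal_minimal[OF \<O>.ideal_principal that]) (intro \<O>.closed qO)
  ultimately have "dvd_in \<O> (q ^ n * q ^ n * q ^ n) x" using xgen by blast
  then obtain x' where x': "x' \<in> \<O>" "x = q ^ n * q ^ n * q ^ n * x'" by (auto simp: dvd_in_def)
  obtain s' where s': "s' \<in> \<O>" "s = q ^ n * s'" using n[OF s(1)] by (auto simp: dvd_in_def)
  have s'q: "\<not> dvd_in \<O> q s'"
  proof
    assume "dvd_in \<O> q s'"
    then obtain v where "v \<in> \<O>" "s' = q * v" by (auto simp: dvd_in_def)
    hence "dvd_in \<O> (q ^ Suc n) s" by (intro \<O>.dvd_inI[of v]) (simp_all add: s'(2))
    with s show False by simp
  qed
  have "s * s * s \<in> S ^ 3" unfolding S3 by (intro set_times_intro s)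
  hence "s * s * s \<in> principal \<O> x" using S(2) \<O>.gen_ideal_subset by blast
  then obtain r where r: "r \<in> \<O>" "s * s * s = x * r" by (auto simp: principal_def)
  have "q ^ n * q ^ n * q ^ n * s' ^ 3 = q ^ n * q ^ n * q ^ n * (x' * r)"
    using r(2) unfolding s'(2) x'(2) by (simp add: power3_eq_cube ac_simps)
  hence sx: "s' ^ 3 = x' * r" using q0 by simp
  have x'q: "\<not> dvd_in \<O> q x'"
  proof
    assume "dvd_in \<O> q x'"
    hence "dvd_in \<O> q (s' ^ 3)" unfolding sx using r by (intro \<O>.dvd_in_mult_right)
    then show False using reduced[OF q s'(1)] s'q by blast
  qed
  obtain d where d: "d \<in> Ok" "d \<noteq> 0" "d * z \<in> \<O>" using clear_denominator[OF z] .
  have z0: "z \<noteq> 0" using eq x(2) by auto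
  obtain k d' where d': "d' \<in> Ok" "d = q ^ k * d'" "\<not> dvd_in Ok q d'" using exact_power_Ok[OF q(1) d(1,2)] .
  have "d * z \<noteq> 0" using d(2) z0 by simp
  obtain l w' where w': "w' \<in> \<O>" "d * z = q ^ l * w'" "\<not> dvd_in \<O> q w'"
    using exact_power_single[OF q(1) d(3) \<open>d * z \<noteq> 0\<close>] .
  have q3: "q ^ (3 * a) = q ^ a * q ^ a * q ^ a" for a
  proof -
    have "3 * a = a + a + a" by simp
    then show ?thesis by (simp only: power_add)
  qed
  \<comment> \<open>With the denominator of \<open>z\<close> cleared, both sides become a power of
    \<open>q\<close> times an element not divisible by \<open>q\<close>; apart from
    \<open>i\<close>, all exponents are multiples of 3.\<close>
  have "x * d ^ 3 = q ^ i * m * (d * z) ^ 3" unfolding eq by (simp add: power_mult_distrib)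
  hence "q ^ (3 * n + 3 * k) * (d' ^ 3 * x') = q ^ (i + 3 * l) * (m * w' ^ 3)"
    unfolding x'(2) w'(2) unfolding d'(2) unfolding power_add q3
    by (simp add: power_mult_distrib power3_eq_cube ac_simps)
  moreover have "\<not> dvd_in \<O> q (d' ^ 3 * x')"
    using prime_dvd_cancel[OF q(1) Ok.power_mem[OF d'(1)] _ x'(1)] x'q d'(3)
      eis_prime_dvd_power[OF q(1) d'(1)] by blast
  moreover have "\<not> dvd_in \<O> q (m * w' ^ 3)"
    using prime_dvd_cancel[OF q(1) m \<O>.power_mem[OF w'(1)]] reduced[OF q w'(1)] w'(3) by blast
  ultimately have "3 * n + 3 * k = i + 3 * l"
    using q0(2) x'(1) w'(1) Ok_mem_O[OF d'(1)] Ok_mem_O[OF m(1)] qO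
    by (intro exact_power_unique[of q _ "d' ^ 3 * x'" _ "m * w' ^ 3"] \<O>.closed)
  then show ?thesis by presburger
qed

text \<open>Among the integral representatives of the class of \<open>m0\<close> modulo cubes of K,
  one of least norm is a unit: any prime factor could be moved into the cube, as \<rho>^3 if it is
  associated to \<pi>, and otherwise as q^3, since its exponent is a multiple of 3.\<close>

lemma ideal_cube_eq_zeta3_cube:
  assumes x: "x \<in> \<O>" "x \<noteq> 0" "ideal_cube x" and m0: "m0 \<in> kF" and z0: "z0 \<in> K" and eq0: "x = m0 * z0 ^ 3"
  obtains i w where "i < (3::nat)" "w \<in> K" "x = zeta3 ^ i * w ^ 3"
proof -
  define P where "P m \<longleftrightarrow> m \<in> Ok \<and> (\<exists>z\<in>K. x = m * z ^ 3)" for m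
  obtain n :: int where n: "n \<noteq> 0" "of_int n * m0 \<in> Ok" using kF_fraction[OF m0] .
  \<comment> \<open>Multiplying by n^3 rather than n clears the denominator without leaving the
    class modulo cubes.\<close>
  have "P (of_int n ^ 2 * (of_int n * m0))"
    unfolding P_def
  proof (intro conjI bexI)
    show "x = of_int n ^ 2 * (of_int n * m0) * (z0 / of_int n) ^ 3"
      using n(1) by (simp add: eq0 power_divide power2_eq_square power3_eq_cube)
  qed (use n z0 in \<open>auto intro: Ok.closed divide_mem_K K.closed\<close>)
  then obtain m where m: "P m" and min: "\<And>m'. P m' \<Longrightarrow> eis_norm m \<le> eis_norm m'"
    using exists_least_iff[of "\<lambda>n. \<exists>d. P d \<and> eis_norm d = n"]
    by (metis (mono_tags, lifting) linorder_le_less_linear)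
  obtain z where z: "m \<in> Ok" "z \<in> K" "x = m * z ^ 3" using m by (auto simp: P_def)
  have mne: "m \<noteq> 0" using z x by auto
  have no_smaller: False if m': "m' \<in> Ok" "f \<in> Ok" "v \<in> K" "m = f * m'" "m * z ^ 3 = m' * v ^ 3" "eis_norm f \<noteq> 1" for m' f v
  proof -
    have "P m'" unfolding P_def using m' z by auto
    hence "eis_norm f * eis_norm m' \<le> eis_norm m'"
      using min m' eis_norm_mult by metis
    moreover have "eis_norm f \<noteq> 0" "eis_norm m' \<noteq> 0"
      using m' mne by (auto simp: eis_norm_eq_0)
    ultimately show False using m'(6) by simp
  qed
  have "eis_norm m = 1"
  proof (rule ccontr)
    assume "eis_norm m \<noteq> 1"
    then obtain q where q: "prime_elem_in Ok q" "dvd_in Ok q m" using prime_divisor_exists[OF z(1) mne] by blast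
    have q0: "q \<in> Ok" "q \<noteq> 0" using q by (auto simp: prime_elem_in_def)
    show False
    proof (cases "dvd_in Ok q \<pi>")
      case True
      then obtain e where e: "e \<in> Ok" "\<pi> = q * e" by (auto simp: dvd_in_def)
      \<comment> \<open>A prime dividing \<pi> is associated to it, so \<pi> itself divides
        \<open>m\<close>.\<close>
      have "dvd_in Ok \<pi> q \<or> dvd_in Ok \<pi> e"
        using eis_prime_dvd_mult[OF prime_pi q0(1) e(1)] Ok.dvd_in_refl e(2) by metis
      moreover have "\<not> dvd_in Ok \<pi> e"
      proof
        assume "dvd_in Ok \<pi> e"
        then obtain f where f: "f \<in> Ok" "e = \<pi> * f" by (auto simp: dvd_in_def)
        hence "\<pi> * (q * f) = \<pi> * 1" using e(2) by (metis mult.left_commute mult.right_neutral)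
        hence "q * f = 1" using pi_nonzero by simp
        then show False using q(1) f(1) by (auto simp: prime_elem_in_def)
      qed
      ultimately have "dvd_in Ok \<pi> m" using q(2) Ok.dvd_in_trans by blast
      then obtain m' where m': "m' \<in> Ok" "m = \<pi> * m'" by (auto simp: dvd_in_def)
      have "m * z ^ 3 = m' * (\<rho> * z) ^ 3" by (simp add: m'(2) power_mult_distrib rho_cube)
      then show False
        using no_smaller[OF m'(1) pi_mem_Ok _ m'(2), of "\<rho> * z"] rho_mem_K z prime_eis_norm[OF prime_pi]
        by (simp add: K.mult_mem)
    next
      case False
      obtain i m' where m': "m' \<in> Ok" "m = q ^ i * m'" "\<not> dvd_in Ok q m'"
        using exact_power_Ok[OF q(1) z(1) mne] .
      have "3 dvd i"
        by (rule content_of_ideal_cube[OF q(1) False x m'(1,3) z(2)]) (simp add: z(3) m'(2))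
      then obtain j where j: "i = 3 * j" ..
      have "j \<noteq> 0"
      proof
        assume "j = 0"
        with m' q(2) j show False by simp
      qed
      then obtain j' where j': "j = Suc j'" by (cases j) auto
      have qi: "q ^ i = q ^ 3 * (q ^ j') ^ 3"
        unfolding j j' by (simp add: power_mult_distrib power_add flip: power_mult) (simp add: mult.commute)
      have "m = q ^ 3 * ((q ^ j') ^ 3 * m')" by (simp add: m'(2) qi)
      moreover from this have "m * z ^ 3 = (q ^ j') ^ 3 * m' * (q * z) ^ 3" by (simp add: power_mult_distrib)
      moreover have "eis_norm (q ^ 3) \<noteq> 1"
        using prime_eis_norm[OF q(1)] by (simp add: power3_eq_cube eis_norm_mult Ok.closed q0)
      ultimately show False
        using q0 m' z by (intro no_smaller[of "(q ^ j') ^ 3 * m'" "q ^ 3" "q * z"])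
          (auto intro: Ok.closed K.closed kF_mem_K Ok_kF)
    qed
  qed
  then obtain i where i: "i < (3::nat)" "m = zeta3 ^ i \<or> m = - (zeta3 ^ i)"
    using eis_norm_eq_1_cases[OF z(1)] by metis
  then show ?thesis
  proof (elim disjE)
    \<comment> \<open>The sign is absorbed because -1 is a cube.\<close>
    assume "m = - (zeta3 ^ i)"
    then show ?thesis using that[of i "- z"] i z by (simp add: K.minus_mem)
  qed (use that i z in blast)
qed

text \<open>The explicit inverse passes to products and conjugates, and it can be lifted to an
  inverse modulo sqrt(-3)^3.\<close>

definition coprime_sqrtm3 :: "complex \<Rightarrow> bool" where
  "coprime_sqrtm3 x \<longleftrightarrow> (\<exists>v\<in>\<O>. cong_in \<O> sqrtm3 (x * v) 1)"

lemma sqrtm3_mem_O: "sqrtm3 \<in> \<O>"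
  by (rule Ok_mem_O[OF sqrtm3_mem_Ok])

lemma coprime_sqrtm3_nonzero: "coprime_sqrtm3 x \<Longrightarrow> x \<noteq> 0"
proof
  assume "coprime_sqrtm3 x" "x = 0"
  hence "dvd_in \<O> sqrtm3 (- 1)" by (auto simp: coprime_sqrtm3_def cong_in_def)
  hence "dvd_in \<O> sqrtm3 1" using \<O>.dvd_in_uminus by force
  hence "dvd_in Ok sqrtm3 1" by (intro dvd_in_O_Ok Ok.closed sqrtm3_mem_Ok)
  then show False using prime_not_dvd_1[OF prime_sqrtm3] by simp
qed

text \<open>Dividing by \<open>w\<close> modulo 3 sqrt(-3) turns \<open>zeta3 ^ i\<close> into the
  cube of some \<kappa>. Then \<kappa> is 1 modulo sqrt(-3) by reducedness, so its cube is 1 modulo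
  3 sqrt(-3); but \<open>zeta3 ^ i - 1\<close> is only a unit times sqrt(-3) unless i = 0.\<close>

lemma primary_cube_zeta3:
  assumes x: "x \<in> \<O>" "coprime_sqrtm3 x" and \<eta>: "\<eta> \<in> \<O>" "cong_in \<O> (3 * sqrtm3) (\<eta> ^ 3) x"
    and w: "w \<in> K" "x = zeta3 ^ i * w ^ 3" and i: "i < 3"
  shows "i = 0"
proof -
  let ?l = "3 * sqrtm3"
  have zO: "zeta3 ^ j \<in> \<O>" for j by (intro \<O>.closed Ok_mem_O[OF zeta3_mem_Ok])
  have zz: "zeta3 ^ (3 - i) * zeta3 ^ i = 1" using i zeta3_cube by (simp flip: power_add)
  have "w ^ 3 = (zeta3 ^ (3 - i) * zeta3 ^ i) * w ^ 3" by (simp add: zz)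
  also have "\<dots> = zeta3 ^ (3 - i) * x" by (simp add: w(2))
  finally have "w ^ 3 \<in> \<O>" using \<O>.mult_mem[OF zO x(1)] by (simp only:)
  hence wO: "w \<in> \<O>" by (rule cube_root_mem_O[OF w(1)])
  obtain x1 where x1: "x1 \<in> \<O>" "cong_in \<O> sqrtm3 (x * x1) 1" using x by (auto simp: coprime_sqrtm3_def)
  define w0 where "w0 = zeta3 ^ i * w ^ 2 * x1"
  have w0: "w0 \<in> \<O>" unfolding w0_def by (intro \<O>.closed zO wO x1)
  have "w * w0 = x * x1" by (simp add: w0_def w(2) power2_eq_square power3_eq_cube)
  hence "dvd_in \<O> sqrtm3 (w * w0 - 1)" using x1(2) by (simp add: cong_in_def)
  then obtain g where g: "g \<in> \<O>" "w * w0 - 1 = sqrtm3 * g" by (auto simp: dvd_in_def)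
  have l3: "sqrtm3 ^ 3 = - ?l" using sqrtm3_square by (simp add: power3_eq_cube power2_eq_square)
  \<comment> \<open>Lifts the inverse of \<open>w\<close> from modulus sqrt(-3) to its cube -3
    sqrt(-3): with t = w w0, the identity is t (3 - 3t + t^2) - 1 = (t - 1)^3.\<close>
  define w2 where "w2 = w0 * (3 - 3 * (w * w0) + (w * w0) ^ 2)"
  have w2: "w2 \<in> \<O>" unfolding w2_def by (intro \<O>.closed w0 wO)
  have "w * w2 - 1 = (w * w0 - 1) ^ 3" by (simp add: w2_def power2_eq_square power3_eq_cube algebra_simps)
  also have "\<dots> = ?l * (- (g ^ 3))" unfolding g(2) power_mult_distrib l3 by simp
  also have "dvd_in \<O> ?l \<dots>" using g by (intro \<O>.dvd_in_self \<O>.closed)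
  finally have inv: "cong_in \<O> ?l (w * w2) 1" by (simp add: cong_in_def)
  define \<kappa> where "\<kappa> = \<eta> * w2"
  have \<kappa>: "\<kappa> \<in> \<O>" unfolding \<kappa>_def by (intro \<O>.closed \<eta> w2)
  have k3: "\<kappa> ^ 3 = \<eta> ^ 3 * w2 ^ 3" by (simp add: \<kappa>_def power_mult_distrib)
  have xw: "x * w2 ^ 3 = zeta3 ^ i * (w * w2) ^ 3" by (simp add: w(2) power_mult_distrib)
  have "cong_in \<O> ?l (\<eta> ^ 3 * w2 ^ 3) (x * w2 ^ 3)"
    by (rule \<O>.cong_in_mult[OF \<eta>(2) \<O>.cong_in_refl x(1) \<O>.power_mem[OF w2]])
  hence c1: "cong_in \<O> ?l (\<kappa> ^ 3) (zeta3 ^ i * (w * w2) ^ 3)" unfolding k3 xw .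
  have "cong_in \<O> ?l (zeta3 ^ i * (w * w2) ^ 3) (zeta3 ^ i * 1 ^ 3)"
    by (rule \<O>.cong_in_mult[OF \<O>.cong_in_refl \<O>.cong_in_power[OF inv \<O>.mult_mem[OF wO w2] \<O>.one_mem]
          zO \<O>.power_mem[OF \<O>.mult_mem[OF wO w2]]])
  hence c2: "cong_in \<O> ?l (zeta3 ^ i * (w * w2) ^ 3) (zeta3 ^ i)" by simp
  have kz: "cong_in \<O> ?l (\<kappa> ^ 3) (zeta3 ^ i)" by (rule \<O>.cong_in_trans[OF c1 c2])
  obtain u where u: "u \<in> Ok" "zeta3 ^ i - 1 = sqrtm3 * u" "i \<noteq> 0 \<Longrightarrow> \<exists>v\<in>Ok. u * v = 1"
  proof -
    consider "i = 0" | "i = 1" | "i = 2" using i by linarith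
    then show ?thesis
    proof cases
      case 1 then show ?thesis using that[of 0] by (simp add: Ok.zero_mem)
    next
      case 2
      have "- (zeta3 ^ 2) * (- zeta3) = 1" using zeta3_cube by (simp add: power2_eq_square power3_eq_cube)
      then show ?thesis using 2 sqrtm3_zeta3(1) that[of "- (zeta3 ^ 2)"]
        by (metis Ok.minus_mem Ok.power_mem zeta3_mem_Ok power_one_right)
    next
      case 3
      have "zeta3 * zeta3 ^ 2 = 1" using zeta3_cube by (simp add: power2_eq_square power3_eq_cube mult.assoc)
      then show ?thesis using 3 sqrtm3_zeta3(2) that[of zeta3]
        by (metis Ok.power_mem zeta3_mem_Ok)
    qed
  qed
  have three: "3 = sqrtm3 * (- sqrtm3)" using sqrtm3_square by (simp add: power2_eq_square)
  have "dvd_in \<O> sqrtm3 (sqrtm3 * 3)" by (rule \<O>.dvd_in_self[OF \<O>.numeral_mem])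
  hence "dvd_in \<O> sqrtm3 ?l" by (simp only: mult.commute)
  hence d1: "dvd_in \<O> sqrtm3 (\<kappa> ^ 3 - zeta3 ^ i)"
    using kz unfolding cong_in_def by (rule \<O>.dvd_in_trans)
  have d2: "dvd_in \<O> sqrtm3 (zeta3 ^ i - 1)"
    unfolding u(2) by (intro \<O>.dvd_in_self Ok_mem_O u)
  have d3: "dvd_in \<O> sqrtm3 (3 * (\<kappa> - \<kappa> ^ 2))"
    unfolding three mult.assoc by (intro \<O>.dvd_in_self \<O>.closed sqrtm3_mem_O \<kappa>)
  have "(\<kappa> - 1) ^ 3 = (\<kappa> ^ 3 - zeta3 ^ i) + (zeta3 ^ i - 1) + 3 * (\<kappa> - \<kappa> ^ 2)"
    by (simp add: power2_eq_square power3_eq_cube algebra_simps)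
  also have "dvd_in \<O> sqrtm3 \<dots>" by (intro \<O>.dvd_in_add d1 d2 d3)
  finally have "dvd_in \<O> sqrtm3 ((\<kappa> - 1) ^ 3)" .
  hence "dvd_in \<O> sqrtm3 (\<kappa> - 1)" by (rule reduced_sqrtm3[OF \<O>.diff_mem[OF \<kappa> \<O>.one_mem]])
  then obtain \<mu> where \<mu>: "\<mu> \<in> \<O>" "\<kappa> - 1 = sqrtm3 * \<mu>" unfolding dvd_in_def by blast
  hence \<mu>': "\<kappa> = 1 + sqrtm3 * \<mu>" by (simp add: diff_eq_eq add.commute)
  \<comment> \<open>Cubing gains the factor 3 because sqrt(-3)^3 is itself a multiple of 3
    sqrt(-3).\<close>
  have "\<kappa> ^ 3 - 1 = ?l * \<mu> + ?l * sqrtm3 * \<mu> ^ 2 + sqrtm3 ^ 3 * \<mu> ^ 3"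
    by (simp add: \<mu>' power2_eq_square power3_eq_cube algebra_simps)
  also have "\<dots> = ?l * (\<mu> + sqrtm3 * \<mu> ^ 2 - \<mu> ^ 3)" unfolding l3 by (simp add: algebra_simps)
  also have "dvd_in \<O> ?l \<dots>" by (intro \<O>.dvd_in_self \<O>.closed \<mu> sqrtm3_mem_O)
  finally have "dvd_in \<O> ?l ((\<kappa> ^ 3 - 1) - (\<kappa> ^ 3 - zeta3 ^ i))"
    using kz unfolding cong_in_def by (rule \<O>.dvd_in_diff)
  hence "dvd_in \<O> (sqrtm3 * 3) (sqrtm3 * u)" using u(2) by (simp add: mult.commute)
  hence "dvd_in \<O> 3 u" by (simp add: \<O>.dvd_in_cancel)
  hence du: "dvd_in Ok 3 u" by (intro dvd_in_O_Ok Ok.closed u)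
  show "i = 0"
  proof (rule ccontr)
    assume "i \<noteq> 0"
    then obtain v where "v \<in> Ok" "u * v = 1" using u(3) by blast
    hence "dvd_in Ok 3 1" using du Ok.dvd_in_mult_right by metis
    moreover have "dvd_in Ok sqrtm3 3"
      unfolding three by (intro Ok.dvd_in_self Ok.closed sqrtm3_mem_Ok)
    ultimately show False using Ok.dvd_in_trans prime_not_dvd_1[OF prime_sqrtm3] by blast
  qed
qed

lemma cube_if_tau_invariant_mod_cubes:
  assumes x: "x \<in> \<O>" "ideal_cube x" "coprime_sqrtm3 x"
    and \<eta>: "\<eta> \<in> \<O>" "cong_in \<O> (3 * sqrtm3) (\<eta> ^ 3) x"
    and y: "y \<in> K" "N y = 1" "\<tau> x = x * y ^ 3"
  obtains w where "w \<in> K" "x = w ^ 3"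
proof -
  obtain z where z: "z \<in> K" "z \<noteq> 0" "y * \<tau> z = z" using hilbert90[OF y(1,2)] .
  have xK: "x \<in> K" by (rule O_mem_K[OF x(1)])
  have "\<tau> (x * z ^ 3) = x * (y * \<tau> z) ^ 3"
    using xK z(1) by (simp add: tau_mult tau_power K.closed y(3) power_mult_distrib)
  hence "\<tau> (x * z ^ 3) = x * z ^ 3" by (simp only: z(3))
  hence "x * z ^ 3 \<in> kF" using xK z by (intro fixed_mem_kF) (simp_all add: K.closed)
  moreover have "x = (x * z ^ 3) * inverse z ^ 3" using z(2) by (simp add: field_simps)
  ultimately obtain i w where iw: "i < (3::nat)" "w \<in> K" "x = zeta3 ^ i * w ^ 3"
    using ideal_cube_eq_zeta3_cube[OF x(1) coprime_sqrtm3_nonzero[OF x(3)] x(2)] inverse_mem_K[OF z(1)] by metis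
  have "i = 0" by (rule primary_cube_zeta3[OF x(1,3) \<eta> iw(2,3,1)])
  with iw show ?thesis using that by simp
qed

section \<open>Closure of ideal cubes and of coprimality to sqrt(-3) under products, units and
  conjugation\<close>

lemma ideal_cube_mult:
  assumes "x \<in> \<O>" "y \<in> \<O>" "ideal_cube x" "ideal_cube y"
  shows "ideal_cube (x * y)"
proof -
  obtain S T where ST: "S \<subseteq> \<O>" "\<O>.gen_ideal (S ^ 3) = principal \<O> x"
    "T \<subseteq> \<O>" "\<O>.gen_ideal (T ^ 3) = principal \<O> y" using assms(3,4) by (auto simp: ideal_cube_def)
  have "\<O>.gen_ideal ((S * T) ^ 3) = principal \<O> (x * y)"
    unfolding power_mult_distrib
    by (intro \<O>.gen_ideal_mult_principal \<O>.set_power_subset assms ST)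
  moreover have "S * T \<subseteq> \<O>" by (intro \<O>.set_times_subset ST)
  ultimately show ?thesis unfolding ideal_cube_def by blast
qed

lemma ideal_cube_power: "x \<in> \<O> \<Longrightarrow> ideal_cube x \<Longrightarrow> 0 < n \<Longrightarrow> ideal_cube (x ^ n)"
proof (induction n)
  case (Suc n)
  then show ?case by (cases n) (auto intro!: ideal_cube_mult \<O>.closed)
qed simp

lemma ideal_cube_unit:
  assumes "a \<in> \<O>" "b \<in> \<O>" "a * b = 1"
  shows "ideal_cube a"
proof -
  have "\<O>.gen_ideal (1 ^ 3) = principal \<O> a"
    unfolding power_one \<O>.gen_ideal_1 by (rule \<O>.principal_one_unit[OF assms, symmetric])
  moreover have "1 \<subseteq> \<O>" using \<O>.one_mem by simp
  ultimately show ?thesis unfolding ideal_cube_def by blast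
qed

text \<open>For the nontrivial inclusion, the preimage under \<tau> of the ideal generated by the
  conjugated cubes is an ideal containing \<open>S ^ 3\<close>, and therefore contains
  \<open>x\<close>.\<close>

lemma ideal_cube_tau:
  assumes "x \<in> \<O>" "ideal_cube x"
  shows "ideal_cube (\<tau> x)"
proof -
  obtain S where S: "S \<subseteq> \<O>" "\<O>.gen_ideal (S ^ 3) = principal \<O> x"
    using assms(2) by (auto simp: ideal_cube_def)
  have SO: "S ^ 3 \<subseteq> \<O>" by (rule \<O>.set_power_subset[OF S(1)])
  have im: "(\<tau> ` S) ^ 3 = \<tau> ` (S ^ 3)"
  proof -
    have mult: "\<tau> ` A * \<tau> ` B = \<tau> ` (A * B)" if "A \<subseteq> \<O>" "B \<subseteq> \<O>" for A B
    proof -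
      have "\<tau> a * \<tau> b = \<tau> (a * b)" if "a \<in> A" "b \<in> B" for a b
        using that \<open>A \<subseteq> \<O>\<close> \<open>B \<subseteq> \<O>\<close> by (simp add: tau_mult O_mem_K subset_eq)
      then show ?thesis unfolding set_times_def by (auto simp: image_iff)
    qed
    show ?thesis unfolding power3_eq_cube using S(1) by (simp add: mult \<O>.set_times_subset)
  qed
  let ?G = "\<O>.gen_ideal ((\<tau> ` S) ^ 3)"
  have tS: "\<tau> ` S \<subseteq> \<O>" using S(1) tau_mem_O by blast
  have G: "ideal_in \<O> ?G" by (intro \<O>.ideal_gen_ideal \<O>.set_power_subset tS)
  have "?G = principal \<O> (\<tau> x)"
  proof
    have "v \<in> {v. dvd_in \<O> (\<tau> x) v}" if v: "v \<in> \<tau> ` (S ^ 3)" for v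
    proof -
      obtain s where s: "s \<in> S ^ 3" "v = \<tau> s" using v by blast
      hence "s \<in> principal \<O> x" using S(2) \<O>.gen_ideal_subset by blast
      then obtain r where r: "r \<in> \<O>" "s = x * r" by (auto simp: principal_def)
      hence "v = \<tau> x * \<tau> r" using s(2) assms(1) by (simp add: tau_mult O_mem_K)
      then show ?thesis using tau_mem_O[OF r(1)] by (auto simp: dvd_in_def)
    qed
    then show "?G \<subseteq> principal \<O> (\<tau> x)"
      unfolding \<O>.principal_eq im
      by (intro \<O>.gen_ideal_minimal \<O>.ideal_principal tau_mem_O assms) blast
    have "ideal_in \<O> {v \<in> \<O>. \<tau> v \<in> ?G}"
      using G unfolding ideal_in_def
      by (auto simp: tau_0 tau_add tau_mult O_mem_K intro: \<O>.closed tau_mem_O)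
    moreover have "S ^ 3 \<subseteq> {v \<in> \<O>. \<tau> v \<in> ?G}"
      using SO \<O>.gen_ideal_subset[of "(\<tau> ` S) ^ 3"] unfolding im by blast
    ultimately have "\<O>.gen_ideal (S ^ 3) \<subseteq> {v \<in> \<O>. \<tau> v \<in> ?G}" by (rule \<O>.gen_ideal_minimal)
    moreover have "x \<in> \<O>.gen_ideal (S ^ 3)" unfolding S(2) \<O>.principal_eq by (simp add: \<O>.dvd_in_refl)
    ultimately have tx: "\<tau> x \<in> ?G" by blast
    show "principal \<O> (\<tau> x) \<subseteq> ?G"
      using tx G unfolding principal_def ideal_in_def by (auto simp: mult.commute)
  qed
  then show ?thesis using tS unfolding ideal_cube_def by blast
qed

lemma coprime_sqrtm3_mult:
  assumes "x \<in> \<O>" "y \<in> \<O>" "coprime_sqrtm3 x" "coprime_sqrtm3 y"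
  shows "coprime_sqrtm3 (x * y)"
proof -
  obtain v w where vw: "v \<in> \<O>" "cong_in \<O> sqrtm3 (x * v) 1" "w \<in> \<O>" "cong_in \<O> sqrtm3 (y * w) 1"
    using assms(3,4) by (auto simp: coprime_sqrtm3_def)
  have "cong_in \<O> sqrtm3 ((x * v) * (y * w)) (1 * 1)"
    by (intro \<O>.cong_in_mult vw \<O>.closed assms)
  then show ?thesis unfolding coprime_sqrtm3_def using vw
    by (intro bexI[of _ "v * w"]) (auto simp: ac_simps intro: \<O>.closed)
qed

lemma coprime_sqrtm3_power: "x \<in> \<O> \<Longrightarrow> coprime_sqrtm3 x \<Longrightarrow> 0 < n \<Longrightarrow> coprime_sqrtm3 (x ^ n)"
proof (induction n)
  case (Suc n)
  then show ?case by (cases n) (auto intro!: coprime_sqrtm3_mult \<O>.closed)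
qed simp

lemma coprime_sqrtm3_unit:
  assumes "b \<in> \<O>" "a * b = 1"
  shows "coprime_sqrtm3 a"
  unfolding coprime_sqrtm3_def using assms \<O>.cong_in_refl by metis

lemma coprime_sqrtm3_tau:
  assumes "x \<in> \<O>" "coprime_sqrtm3 x"
  shows "coprime_sqrtm3 (\<tau> x)"
proof -
  obtain v where v: "v \<in> \<O>" "cong_in \<O> sqrtm3 (x * v) 1"
    using assms(2) by (auto simp: coprime_sqrtm3_def)
  have "dvd_in \<O> sqrtm3 (\<tau> (x * v - 1))"
    using v(2) sqrtm3_mem_Ok unfolding cong_in_def by (rule dvd_in_tau[rotated])
  hence "cong_in \<O> sqrtm3 (\<tau> x * \<tau> v) 1"
    using assms v by (simp add: cong_in_def tau_diff tau_mult tau_1 O_mem_K K.closed)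
  then show ?thesis unfolding coprime_sqrtm3_def using tau_mem_O[OF v(1)] by blast
qed

lemma twisted_ideal_cube_is_cube:
  assumes \<gamma>: "\<gamma> \<in> \<O>" "ideal_cube \<gamma>" "coprime_sqrtm3 \<gamma>"
    and u: "u = zeta3 ^ c * \<gamma> ^ 2 * \<tau> \<gamma>"
    and \<eta>: "\<eta> \<in> \<O>" "cong_in \<O> (3 * sqrtm3) (\<eta> ^ 3) u"
  obtains w where "w \<in> K" "u = w ^ 3"
proof -
  have zO: "zeta3 ^ j \<in> \<O>" for j by (intro \<O>.closed Ok_mem_O[OF zeta3_mem_Ok])
  have zinv: "zeta3 ^ c * zeta3 ^ (2 * c) = 1"
  proof -
    have "zeta3 ^ c * zeta3 ^ (2 * c) = zeta3 ^ (3 * c)" by (simp flip: power_add)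
    also have "\<dots> = 1" by (simp add: power_mult zeta3_cube)
    finally show ?thesis .
  qed
  have t\<gamma>: "\<tau> \<gamma> \<in> \<O>" "\<tau> (\<tau> \<gamma>) \<in> \<O>" using \<gamma> by (auto intro: tau_mem_O)
  have uO: "u \<in> \<O>" unfolding u by (intro \<O>.closed zO t\<gamma> \<gamma>)
  have uc: "ideal_cube u" unfolding u
    by (intro ideal_cube_mult ideal_cube_power ideal_cube_unit[OF zO zO zinv] ideal_cube_tau \<gamma> t\<gamma>
        \<O>.power_mem \<O>.mult_mem zO) simp
  have up: "coprime_sqrtm3 u" unfolding u
    by (intro coprime_sqrtm3_mult coprime_sqrtm3_power coprime_sqrtm3_unit[OF zO zinv] coprime_sqrtm3_tau \<gamma> t\<gamma>
        \<O>.power_mem \<O>.mult_mem zO) simp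
  have K: "\<gamma> \<in> K" "\<tau> \<gamma> \<in> K" "\<tau> (\<tau> \<gamma>) \<in> K" "u \<in> K" "\<tau> u \<in> K" "\<tau> (\<tau> u) \<in> K"
    using \<gamma> t\<gamma> uO by (auto intro: O_mem_K tau_mem_O)
  have nz: "\<gamma> \<noteq> 0" "u \<noteq> 0" "\<tau> u \<noteq> 0" using coprime_sqrtm3_nonzero[OF \<gamma>(3)] coprime_sqrtm3_nonzero[OF up] tau_eq_0[OF K(4)] by auto
  have n\<gamma>: "N \<gamma> \<in> kF" "N \<gamma> \<noteq> 0" using norm_mem_kF[OF K(1)] norm_eq_0[OF K(1)] nz by auto
  have \<tau>u: "\<tau> u = zeta3 ^ c * \<tau> \<gamma> ^ 2 * \<tau> (\<tau> \<gamma>)"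
    unfolding u using K zO by (simp add: tau_mult tau_power K.closed O_mem_K tau_k kF.closed zeta3_mem_kF)
  have Nu: "N u = N \<gamma> ^ 3"
  proof -
    have "N (zeta3 ^ c) = 1"
    proof -
      have "(zeta3 ^ c) ^ 3 = (zeta3 ^ 3) ^ c" by (simp flip: power_mult add: mult.commute)
      then show ?thesis
        using norm_kF[OF kF.power_mem[OF zeta3_mem_kF], of c] by (simp add: zeta3_cube)
    qed
    then show ?thesis unfolding u using K zO
      by (simp add: norm_mult K.closed O_mem_K norm_tau power2_eq_square power3_eq_cube)
  qed
  \<comment> \<open>Modulo cubes this is (1 - \<tau>) u, and \<tau> - 1 sends it to the inverse of N
    u, a cube by \<open>Nu\<close>.\<close>
  define x where "x = u * \<tau> u ^ 2"
  have "\<exists>w1\<in>K. x = w1 ^ 3"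
  proof -
    have tu: "\<tau> u \<in> \<O>" "ideal_cube (\<tau> u)" "coprime_sqrtm3 (\<tau> u)"
      using uO uc up tau_mem_O ideal_cube_tau coprime_sqrtm3_tau by blast+
    have x: "x \<in> \<O>" "ideal_cube x" "coprime_sqrtm3 x"
      unfolding x_def using uO uc up tu
      by (auto intro!: \<O>.closed ideal_cube_mult ideal_cube_power coprime_sqrtm3_mult coprime_sqrtm3_power)
    have \<tau>\<eta>: "\<tau> \<eta> \<in> \<O>" by (rule tau_mem_O[OF \<eta>(1)])
    have "dvd_in \<O> (3 * sqrtm3) (\<tau> (\<eta> ^ 3 - u))"
      using \<eta>(2) unfolding cong_in_def by (intro dvd_in_tau Ok.closed sqrtm3_mem_Ok)
    hence c: "cong_in \<O> (3 * sqrtm3) (\<tau> \<eta> ^ 3) (\<tau> u)"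
      using O_mem_K[OF \<eta>(1)] K by (simp add: cong_in_def tau_diff tau_power K.closed)
    have "cong_in \<O> (3 * sqrtm3) (\<eta> ^ 3 * (\<tau> \<eta> ^ 3) ^ 2) (u * \<tau> u ^ 2)"
      by (intro \<O>.cong_in_mult \<O>.cong_in_power \<eta> c uO tu \<O>.closed \<tau>\<eta>)
    moreover have "(\<eta> * \<tau> \<eta> ^ 2) ^ 3 = \<eta> ^ 3 * (\<tau> \<eta> ^ 3) ^ 2"
      by (simp add: power_mult_distrib mult.commute flip: power_mult)
    ultimately have x\<eta>: "cong_in \<O> (3 * sqrtm3) ((\<eta> * \<tau> \<eta> ^ 2) ^ 3) x" by (simp add: x_def)
    \<comment> \<open>An explicit cube root of \<open>\<tau> x / x\<close>. Dividing by N \<gamma>,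
      and not by another cube root of N u, also normalizes its norm to 1.\<close>
    define y where "y = \<tau> (\<tau> u) / N \<gamma>"
    have y: "y \<in> K" unfolding y_def by (intro divide_mem_K K kF_mem_K n\<gamma>)
    have Ny: "N y = 1"
      unfolding y_def using n\<gamma> K by (simp add: norm_divide kF_mem_K norm_tau Nu norm_kF)
    have "\<tau> x = \<tau> u * \<tau> (\<tau> u) ^ 2" unfolding x_def using K by (simp add: tau_mult tau_power K.closed)
    moreover have "x * y ^ 3 = \<tau> u * \<tau> (\<tau> u) ^ 2 * (N u / N \<gamma> ^ 3)"
      unfolding x_def y_def normK1_def[of \<tau> u]
      by (simp add: power_divide power2_eq_square power3_eq_cube)
    ultimately have "\<tau> x = x * y ^ 3" using Nu n\<gamma> by simp
    then show ?thesis
      using cube_if_tau_invariant_mod_cubes[OF x \<O>.mult_mem[OF \<eta>(1) \<O>.power_mem[OF \<tau>\<eta>]] x\<eta> y Ny] by blast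
  qed
  then obtain w1 where w1: "w1 \<in> K" "x = w1 ^ 3" by blast
  have "w1 \<noteq> 0" using w1(2) nz unfolding x_def by auto
  \<comment> \<open>The quotient \<open>\<tau> u / u\<close> equals the cube of
    \<open>\<tau> u\<close> divided by \<open>x\<close>, and \<open>x\<close> is the cube of
    \<open>w1\<close>.\<close>
  define y where "y = \<tau> u / w1"
  have y: "y \<in> K" unfolding y_def by (intro divide_mem_K K w1)
  have uy: "\<tau> u = u * y ^ 3"
    unfolding y_def power_divide w1(2)[symmetric] x_def
    using nz by (simp add: power2_eq_square power3_eq_cube)
  \<comment> \<open>Serves to prove N y = 1. By the shape of \<open>u\<close>, the quotient
    \<open>\<tau> u / u\<close> is N \<gamma> / \<gamma>^3, so \<open>v ^ 3\<close> lies in the base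
    field, N v equals \<open>v ^ 3\<close>, and N v = N \<gamma> follows.\<close>
  define v where "v = y * \<gamma>"
  have vK: "v \<in> K" unfolding v_def by (intro K.closed y K)
  have v3: "v ^ 3 = N \<gamma>"
  proof -
    have "u * v ^ 3 = \<tau> u * \<gamma> ^ 3" by (simp add: v_def power_mult_distrib uy)
    also have "\<dots> = u * N \<gamma>"
      unfolding \<tau>u unfolding u normK1_def by (simp add: power2_eq_square power3_eq_cube)
    finally show ?thesis using nz by simp
  qed
  have v0: "v \<noteq> 0" using v3 n\<gamma> by auto
  text \<open>\<open>\<tau> v / v\<close> is a cube root of unity because \<open>v\<^sup>3\<close> lies in the base field.\<close>
  define e where "e = \<tau> v / v"
  have eK: "e \<in> K" unfolding e_def by (intro divide_mem_K tau_mem_K vK)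
  have e3: "e ^ 3 = 1"
  proof -
    have "\<tau> v ^ 3 = v ^ 3" unfolding tau_power[OF vK, symmetric] v3 by (rule tau_k[OF n\<gamma>(1)])
    then show ?thesis using v0 by (simp add: e_def power_divide)
  qed
  have ek: "e \<in> kF"
  proof -
    obtain i where "e = zeta3 ^ i * 1" using cube_eq_imp_zeta3[of e 1] e3 by auto
    then show ?thesis using kF.power_mem[OF zeta3_mem_kF] by simp
  qed
  have \<tau>v: "\<tau> v = e * v" using v0 by (simp add: e_def)
  hence "\<tau> (\<tau> v) = e * (e * v)" using ek eK vK by (simp add: tau_mult tau_k)
  hence "N v = e ^ 3 * v ^ 3" unfolding normK1_def by (simp add: \<tau>v power3_eq_cube)
  hence "N v = N \<gamma>" by (simp add: e3 v3)
  hence "N y = 1" using n\<gamma> y K by (simp add: v_def norm_mult)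
  then show ?thesis
    using cube_if_tau_invariant_mod_cubes[OF uO uc up \<eta> y _ uy] that by blast
qed

section \<open>Consequences of admissibility\<close>

lemma admissible_cases:
  assumes adm: "admissible \<rho> \<tau> p P \<theta>"
    and P: "ideal_in \<O> P" "p \<in> P" and p: "cong_in Ok (3 * sqrtm3) p 1"
  obtains c \<alpha> a b B \<eta> where
    "\<alpha> \<in> \<O>" "coprime_sqrtm3 \<alpha>" "\<theta> = zeta3 ^ c * \<alpha> ^ 2 * \<tau> \<alpha>"
    "B \<subseteq> \<O>" "\<O>.gen_ideal (P ^ a * B ^ b) = principal \<O> \<alpha>" "\<not> 3 dvd a" "3 dvd b"
    "\<eta> \<in> \<O>" "cong_in \<O> (3 * sqrtm3) (\<eta> ^ 3) \<theta>"
proof -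
  obtain c \<alpha> and a b :: nat and B where \<alpha>: "\<alpha> \<in> \<O>" and B: "ideal_in \<O> B" "coprime_ideals B (principal \<O> 3)"
    and ab: "\<not> 3 dvd a" "3 dvd b"
    and id: "principal \<O> \<alpha> = ideal_mult \<O> (ideal_pow \<O> P a) (ideal_pow \<O> B b)"
    and \<theta>: "\<theta> = zeta3 ^ c * \<alpha> ^ 2 * \<tau> \<alpha>"
    using adm unfolding admissible_def by blast
  obtain \<eta> where \<eta>: "\<eta> \<in> \<O>" "cong_in \<O> (3 * sqrtm3) (\<eta> ^ 3) \<theta>"
    using adm unfolding admissible_def by blast
  have PB: "P \<subseteq> \<O>" "B \<subseteq> \<O>" using P B by (auto simp: ideal_in_def)
  have gen: "\<O>.gen_ideal (P ^ a * B ^ b) = principal \<O> \<alpha>"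
    unfolding id \<O>.ideal_mult_eq \<O>.ideal_pow_eq[OF P(1)] \<O>.ideal_pow_eq[OF B(1)]
    by (intro \<O>.gen_ideal_mult[symmetric] \<O>.set_power_subset PB)
  have three: "3 = sqrtm3 * (- sqrtm3)" using sqrtm3_square by (simp add: power2_eq_square)
  have d3: "dvd_in \<O> sqrtm3 3"
    unfolding three by (intro \<O>.dvd_in_self \<O>.closed sqrtm3_mem_O)
  hence dl: "dvd_in \<O> sqrtm3 (3 * sqrtm3)" by (rule \<O>.dvd_in_mult_right[OF _ sqrtm3_mem_O])
  have p1: "cong_in \<O> sqrtm3 p 1"
    using dvd_in_Ok_O p dl \<O>.dvd_in_trans unfolding cong_in_def by blast
  obtain x y where xy: "x \<in> B" "y \<in> principal \<O> 3" "x + y = 1" using B(2) by (auto simp: coprime_ideals_def)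
  have "x - 1 = - y" using xy(3) by (simp add: algebra_simps)
  moreover have "dvd_in \<O> sqrtm3 y" using xy(2) d3 \<O>.dvd_in_trans unfolding \<O>.principal_eq by blast
  ultimately have x1: "cong_in \<O> sqrtm3 x 1" unfolding cong_in_def using \<O>.dvd_in_uminus by metis
  have pO: "p \<in> \<O>" and xO: "x \<in> \<O>" using P(2) xy(1) PB by auto
  \<comment> \<open>Coprimality of \<alpha> to sqrt(-3): this element of the ideal generated by
    \<alpha> is 1 modulo sqrt(-3), so its cofactor is an inverse of \<alpha>.\<close>
  have "cong_in \<O> sqrtm3 (p ^ a * x ^ b) (1 ^ a * 1 ^ b)"
    by (rule \<O>.cong_in_mult[OF \<O>.cong_in_power[OF p1 pO \<O>.one_mem] \<O>.cong_in_power[OF x1 xO \<O>.one_mem]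
          \<O>.power_mem[OF \<O>.one_mem] \<O>.power_mem[OF xO]])
  moreover have "p ^ a * x ^ b \<in> P ^ a * B ^ b"
    by (intro set_times_intro set_power_intro P(2) xy(1))
  hence "p ^ a * x ^ b \<in> principal \<O> \<alpha>" using gen \<O>.gen_ideal_subset by blast
  then obtain r where "r \<in> \<O>" "p ^ a * x ^ b = \<alpha> * r" by (auto simp: principal_def)
  ultimately have "coprime_sqrtm3 \<alpha>" unfolding coprime_sqrtm3_def by auto
  with \<alpha> \<theta> PB(2) gen ab \<eta> show ?thesis by (intro that)
qed

text \<open>The exponent \<open>s\<close> is chosen such that \<open>\<alpha> \<alpha>'\<^sup>s\<close> generates the cube of an ideal.\<close>

lemma admissible_product_cube:
  assumes adm: "admissible \<rho> \<tau> p P \<theta>" and adm': "admissible \<rho> \<tau> p P \<theta>'"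
    and P: "ideal_in \<O> P" "p \<in> P" and p: "cong_in Ok (3 * sqrtm3) p 1"
  obtains s w where "w \<in> K" "\<theta> * \<theta>' ^ s = w ^ 3" "\<theta>' \<noteq> 0"
proof -
  obtain c \<alpha> a b B \<eta> where 1:
    "\<alpha> \<in> \<O>" "coprime_sqrtm3 \<alpha>" "\<theta> = zeta3 ^ c * \<alpha> ^ 2 * \<tau> \<alpha>"
    "B \<subseteq> \<O>" "\<O>.gen_ideal (P ^ a * B ^ b) = principal \<O> \<alpha>" "\<not> 3 dvd a" "3 dvd b"
    "\<eta> \<in> \<O>" "cong_in \<O> (3 * sqrtm3) (\<eta> ^ 3) \<theta>"
    using admissible_cases[OF adm P p] .
  obtain c' \<alpha>' a' b' B' \<eta>' where 2:
    "\<alpha>' \<in> \<O>" "coprime_sqrtm3 \<alpha>'" "\<theta>' = zeta3 ^ c' * \<alpha>' ^ 2 * \<tau> \<alpha>'"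
    "B' \<subseteq> \<O>" "\<O>.gen_ideal (P ^ a' * B' ^ b') = principal \<O> \<alpha>'" "\<not> 3 dvd a'" "3 dvd b'"
    "\<eta>' \<in> \<O>" "cong_in \<O> (3 * sqrtm3) (\<eta>' ^ 3) \<theta>'"
    using admissible_cases[OF adm' P p] .
  have PO: "P \<subseteq> \<O>" using P by (simp add: ideal_in_def)
  \<comment> \<open>Two nonzero residues modulo 3 are equal or opposite: s = 2 handles the first
    case, s = 1 the second.\<close>
  have "3 dvd a + a' * 1 \<or> 3 dvd a + a' * 2" using 1(6) 2(6) by presburger
  then obtain s where s: "s = 1 \<or> s = 2" "3 dvd a + a' * s" by blast
  obtain e f f' where e: "a + a' * s = 3 * e" "b = 3 * f" "b' = 3 * f'"
    using s(2) 1(7) 2(7) by (auto elim!: dvdE)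
  define \<gamma> where "\<gamma> = \<alpha> * \<alpha>' ^ s"
  \<comment> \<open>The formal cube root of the factorization of \<gamma>; all three exponents are
    now multiples of 3.\<close>
  define T where "T = P ^ e * B ^ f * B' ^ (f' * s)"
  have \<gamma>O: "\<gamma> \<in> \<O>" unfolding \<gamma>_def by (intro \<O>.closed 1 2)
  have "P ^ a * B ^ b * (P ^ a' * B' ^ b') ^ s = P ^ (a + a' * s) * B ^ b * B' ^ (b' * s)"
    by (simp add: power_mult_distrib power_add power_mult ac_simps)
  also have "\<dots> = T ^ 3"
    unfolding e T_def by (simp add: power_mult_distrib ac_simps flip: power_mult)
  finally have T3: "P ^ a * B ^ b * (P ^ a' * B' ^ b') ^ s = T ^ 3" .
  have T: "T \<subseteq> \<O>" unfolding T_def by (intro \<O>.set_times_subset \<O>.set_power_subset PO 1 2)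
  have "\<O>.gen_ideal (T ^ 3) = principal \<O> \<gamma>"
    unfolding T3[symmetric] \<gamma>_def
    by (intro \<O>.gen_ideal_mult_principal \<O>.gen_ideal_power_principal 1 2 \<O>.power_mem
        \<O>.set_times_subset \<O>.set_power_subset PO)
  hence cube: "ideal_cube \<gamma>" unfolding ideal_cube_def using T by blast
  have copr: "coprime_sqrtm3 \<gamma>"
    unfolding \<gamma>_def using s(1)
    by (intro coprime_sqrtm3_mult coprime_sqrtm3_power 1 2 \<O>.power_mem) auto
  have tO: "\<tau> \<alpha> \<in> \<O>" "\<tau> \<alpha>' \<in> \<O>" using 1(1) 2(1) by (auto intro: tau_mem_O)
  have zO: "zeta3 \<in> \<O>" by (rule Ok_mem_O[OF zeta3_mem_Ok])
  have \<theta>O: "\<theta> \<in> \<O>" "\<theta>' \<in> \<O>" unfolding 1(3) 2(3) by (intro \<O>.closed zO tO 1 2)+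
  have nz: "\<theta>' \<noteq> 0"
    unfolding 2(3) using coprime_sqrtm3_nonzero[OF 2(2)] 2(1) by (simp add: tau_eq_0 O_mem_K)
  have u: "\<theta> * \<theta>' ^ s = zeta3 ^ (c + c' * s) * \<gamma> ^ 2 * \<tau> \<gamma>"
  proof -
    have "\<tau> \<gamma> = \<tau> \<alpha> * \<tau> \<alpha>' ^ s"
      unfolding \<gamma>_def using 1(1) 2(1) by (simp add: tau_mult tau_power O_mem_K K.closed)
    moreover have "\<theta>' ^ s = zeta3 ^ (c' * s) * (\<alpha>' ^ s) ^ 2 * \<tau> \<alpha>' ^ s"
      by (simp only: 2(3) power_mult_distrib power_mult[symmetric] mult.commute[of 2 s])
    ultimately show ?thesis
      by (simp add: 1(3) \<gamma>_def power_mult_distrib power_add ac_simps)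
  qed
  have "cong_in \<O> (3 * sqrtm3) (\<eta> ^ 3 * (\<eta>' ^ 3) ^ s) (\<theta> * \<theta>' ^ s)"
    by (rule \<O>.cong_in_mult[OF 1(9) \<O>.cong_in_power[OF 2(9) \<O>.power_mem[OF 2(8)] \<theta>O(2)] \<theta>O(1)
          \<O>.power_mem[OF \<O>.power_mem[OF 2(8)]]])
  moreover have "(\<eta> * \<eta>' ^ s) ^ 3 = \<eta> ^ 3 * (\<eta>' ^ 3) ^ s"
    by (simp add: power_mult_distrib mult.commute flip: power_mult)
  ultimately have "cong_in \<O> (3 * sqrtm3) ((\<eta> * \<eta>' ^ s) ^ 3) (\<theta> * \<theta>' ^ s)" by simp
  then obtain w where "w \<in> K" "\<theta> * \<theta>' ^ s = w ^ 3"
    using twisted_ideal_cube_is_cube[OF \<gamma>O cube copr u \<O>.mult_mem[OF 1(8) \<O>.power_mem[OF 2(8)]]] by blast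
  then show ?thesis using nz by (rule that)
qed

section \<open>Comparison of the generated fields\<close>

lemma K_subset_gen_field: "K \<subseteq> gen_field (kF \<union> insert \<rho> S)"
proof
  fix x assume "x \<in> K"
  then obtain c0 c1 c2 where c: "c0 \<in> kF" "c1 \<in> kF" "c2 \<in> kF" "x = c0 + c1 * \<rho> + c2 * \<rho> ^ 2"
    by (elim K_E)
  let ?F = "gen_field (kF \<union> insert \<rho> S)"
  interpret F: complex_subring ?F by (rule subfield_C_subring[OF subfield_gen_field])
  have "c0 \<in> ?F" "c1 \<in> ?F" "c2 \<in> ?F" "\<rho> \<in> ?F"
    using c by (auto intro!: subsetD[OF gen_field_subset])
  then show "x \<in> ?F" unfolding c(4) by (intro F.closed)
qed

text \<open>Cube roots are determined up to powers of \<open>zeta3\<close>, which lie in the base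
  field; so \<open>t\<close> is a quotient of an element of K by a power of
  \<open>t'\<close>.\<close>

lemma mem_gen_field_if_twisted_cube:
  assumes w: "w \<in> K" and eq: "(t * t' ^ s) ^ 3 = w ^ 3" "t' \<noteq> 0"
  shows "t \<in> gen_field (kF \<union> {\<rho>, r, t'})"
proof -
  let ?F = "gen_field (kF \<union> {\<rho>, r, t'})"
  have F: "subfield_C ?F" by (rule subfield_gen_field)
  have t': "t' \<in> ?F" by (rule subsetD[OF gen_field_subset]) simp
  obtain i where "t * t' ^ s = zeta3 ^ i * w" using cube_eq_imp_zeta3[OF eq(1)] .
  hence t_eq: "t = zeta3 ^ i * w / t' ^ s" using eq(2) by (simp add: field_simps)
  have "zeta3 ^ i * w \<in> ?F"
    using K_subset_gen_field[of "{r, t'}"] K.mult_mem[OF K.power_mem[OF kF_mem_K[OF zeta3_mem_kF]] w] by blast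
  then show ?thesis unfolding t_eq by (intro subfield_C_divide[OF F] subfield_C_power[OF F] t')
qed

end

theorem theorem4p11:
  fixes \<pi>1 \<pi>2 \<rho> r2 \<theta> \<theta>' t t' :: complex
    and \<tau> :: "complex \<Rightarrow> complex"
    and P :: "complex set"
  assumes p1: "prime_elem_in Ok \<pi>1" and p2: "prime_elem_in Ok \<pi>2"
    and n3_1: "\<not> dvd_in Ok \<pi>1 3" and n3_2: "\<not> dvd_in Ok \<pi>2 3"
    and N1: "\<exists>n::int. \<pi>1 * cnj \<pi>1 = of_int n \<and> n mod 9 = 1"
    and N2: "\<exists>n::int. \<pi>2 * cnj \<pi>2 = of_int n \<and> n mod 9 = 1"
    and distinct: "\<not> dvd_in Ok \<pi>1 \<pi>2"
    and prim1: "cong_in Ok (3 * sqrtm3) \<pi>1 1"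
    and prim2: "cong_in Ok (3 * sqrtm3) \<pi>2 1"
    and cube12: "cube_in_completion Ok \<pi>2 \<pi>1"
    and cube21: "cube_in_completion Ok \<pi>1 \<pi>2"
    and rho: "\<rho> ^ 3 = \<pi>1"
    and tau_add: "\<forall>x\<in>K1 \<rho>. \<forall>y\<in>K1 \<rho>. \<tau> (x + y) = \<tau> x + \<tau> y"
    and tau_mult: "\<forall>x\<in>K1 \<rho>. \<forall>y\<in>K1 \<rho>. \<tau> (x * y) = \<tau> x * \<tau> y"
    and tau_k: "\<forall>c\<in>kF. \<tau> c = c"
    and tau_rho: "\<tau> \<rho> = zeta3 * \<rho>"
    and P: "prime_ideal_in (OK1 \<rho>) P" and P_over: "\<pi>2 \<in> P"
    and adm: "admissible \<rho> \<tau> \<pi>2 P \<theta>" and adm': "admissible \<rho> \<tau> \<pi>2 P \<theta>'"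
    and r2: "r2 ^ 3 = \<pi>2" and t: "t ^ 3 = \<theta>" and t': "t' ^ 3 = \<theta>'"
  shows "gen_field (kF \<union> {\<rho>, r2, t}) = gen_field (kF \<union> {\<rho>, r2, t'})"
proof -
  interpret cubic_extension \<rho> \<pi>1 \<tau>
    by unfold_locales (use p1 prim1 rho tau_add tau_mult tau_k tau_rho in blast)+
  have id: "ideal_in \<O> P" using P by (simp add: prime_ideal_in_def)
  \<comment> \<open>One inclusion, for an arbitrary ordered pair of admissible elements; exchanging
    the two gives the other.\<close>
  have "gen_field (kF \<union> {\<rho>, r2, u}) \<subseteq> gen_field (kF \<union> {\<rho>, r2, u'})"
    if \<phi>: "admissible \<rho> \<tau> \<pi>2 P \<phi>" "admissible \<rho> \<tau> \<pi>2 P \<phi>'" and u: "u ^ 3 = \<phi>" "u' ^ 3 = \<phi>'"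
    for \<phi> \<phi>' u u'
  proof -
    obtain s w where w: "w \<in> K" "\<phi> * \<phi>' ^ s = w ^ 3" "\<phi>' \<noteq> 0"
      using admissible_product_cube[OF \<phi> id P_over prim2] by metis
    let ?F = "gen_field (kF \<union> {\<rho>, r2, u'})"
    have "(u * u' ^ s) ^ 3 = (u ^ 3) * (u' ^ 3) ^ s"
      by (simp add: power_mult_distrib mult.commute flip: power_mult)
    hence "(u * u' ^ s) ^ 3 = w ^ 3" unfolding u w(2) .
    moreover have "u' \<noteq> 0" using u(2) w(3) by auto
    ultimately have "u \<in> ?F" by (rule mem_gen_field_if_twisted_cube[OF w(1)])
    moreover have "kF \<union> {\<rho>, r2, u'} \<subseteq> ?F" by (rule gen_field_subset)
    ultimately show ?thesis by (intro gen_field_minimal) blast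
  qed
  then show ?thesis using adm adm' t t' by (intro subset_antisym) blast+
qed

end
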